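(* There exists a constant $C>0$ such that the following holds. Let $I=(0,1)$ and let $u\in\mathcal{U}$ be positive, bounded away from zero, and satisfy $\int_I u\,dx=1$. Define the measures $d\mu=u\,dx$ and $d\mu_\infty=(P_\infty u)\,dx$ on $[0,1]$. Then \[ W_2^2(\mu,\mu_\infty)\le\frac{C}{\inf u}\,\mathcal{E}^-(u). \]
   Context: For $w\in L^2(I)$, $\mathcal{R}(w)$ is the set of $(w_1,w_2)\in L^2(I)\times H^1(I)$ with $w_1$ nondecreasing, $w_2$ nonincreasing (having such representatives), $\int_I w_2=0$ and $w=w_1+w_2$ a.e.; $\mathcal{U}=\{w:\mathcal{R}(w)\ne\emptyset\}$; for $w\in\mathcal{U}$, $(w^\uparrow,w^\downarrow)$ is the unique element of $\mathcal{R}(w)$ minimizing $\frac12\int_I(\partial_xw_2)^2$. The directed Dirichlet energy $\mathcal{E}^-:L^2(I)\to[0,\infty]$ is $\mathcal{E}^-(w)=\frac12\int_I(\partial_xw^\downarrow)^2dx$ for $w\in\mathcal{U}$ and $+\infty$ otherwise; it is convex, proper and lower semicontinuous. $(P_t)_{t\ge0}$ is the nonexpansive semigroup on $L^2(I)$ generated by $-\partial\mathcal{E}^-$ (subdifferential): for $w\in\mathcal{U}$, $t\mapsto P_tw$ is the unique solution of $\frac{d}{dt}\mathbf{w}(t)\in-\partial\mathcal{E}^-(\mathbf{w}(t))$ for a.e. $t>0$ with $\mathbf{w}(0)=w$, and $P_t$ is extended to $L^2(I)$ by continuity. For every $w\in L^2(I)$, $P_tw$ converges in $L^2(I)$ as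 $t\to\infty$ to a nondecreasing function, denoted $P_\infty w$. $\inf u$ denotes the essential infimum. $W_2$ is the $2$-Wasserstein distance: $W_2^2(\mu,\nu)=\inf_{\gamma}\int|x-y|^2d\gamma(x,y)$ over couplings $\gamma$ of $\mu$ and $\nu$. *)

theory Defs
  imports "HOL-Analysis.Analysis" "HOL-Probability.Essential_Supremum"
begin

text \<open>
  Elements of \<open>L\<^sup>2(I)\<close> are represented by Borel functions \<open>real \<Rightarrow> real\<close>; two functions that agree
  almost everywhere on the interval \<open>I = (0,1)\<close> represent the same element, and the values outside
  \<open>I\<close> are irrelevant.
\<close>

abbreviation I :: "real set" where
  "I \<equiv> {0<..<1}"

abbreviation leb_I :: "real measure" where
  "leb_I \<equiv> restrict_space lborel I"

definition L2_I :: "(real \<Rightarrow> real) set" where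
  "L2_I = {f \<in> borel_measurable leb_I. integrable leb_I (\<lambda>x. (f x)\<^sup>2)}"

definition L2_inner :: "(real \<Rightarrow> real) \<Rightarrow> (real \<Rightarrow> real) \<Rightarrow> real" where
  "L2_inner f g = (LINT x|leb_I. f x * g x)"

definition L2_norm :: "(real \<Rightarrow> real) \<Rightarrow> real" where
  "L2_norm f = sqrt (LINT x|leb_I. (f x)\<^sup>2)"

definition L2_dist :: "(real \<Rightarrow> real) \<Rightarrow> (real \<Rightarrow> real) \<Rightarrow> real" where
  "L2_dist f g = L2_norm (\<lambda>x. f x - g x)"

definition test_functions :: "(real \<Rightarrow> real) set" where
  "test_functions = {\<phi>. (\<forall>n. (deriv ^^ n) \<phi> differentiable_on UNIV) \<and>
     (\<exists>K. compact K \<and> K \<subseteq> I \<and> (\<forall>x. x \<notin> K \<longrightarrow> \<phi> x = 0))}"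

definition is_weak_deriv :: "(real \<Rightarrow> real) \<Rightarrow> (real \<Rightarrow> real) \<Rightarrow> bool" where
  "is_weak_deriv f g \<longleftrightarrow> f \<in> L2_I \<and> g \<in> L2_I \<and>
     (\<forall>\<phi>\<in>test_functions. (LINT x|leb_I. f x * deriv \<phi> x) = - (LINT x|leb_I. g x * \<phi> x))"

definition H1_I :: "(real \<Rightarrow> real) set" where
  "H1_I = {f. \<exists>g. is_weak_deriv f g}"

definition weak_deriv :: "(real \<Rightarrow> real) \<Rightarrow> real \<Rightarrow> real" where
  "weak_deriv f = (SOME g. is_weak_deriv f g)"

definition dirichlet :: "(real \<Rightarrow> real) \<Rightarrow> real" where
  "dirichlet f = 1/2 * (LINT x|leb_I. (weak_deriv f x)\<^sup>2)"

definition ae_nondecreasing :: "(real \<Rightarrow> real) \<Rightarrow> bool" where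
  "ae_nondecreasing f \<longleftrightarrow> (\<exists>g. mono_on I g \<and> (AE x in leb_I. f x = g x))"

definition ae_nonincreasing :: "(real \<Rightarrow> real) \<Rightarrow> bool" where
  "ae_nonincreasing f \<longleftrightarrow> (\<exists>g. antimono_on I g \<and> (AE x in leb_I. f x = g x))"

definition decomps :: "(real \<Rightarrow> real) \<Rightarrow> ((real \<Rightarrow> real) \<times> (real \<Rightarrow> real)) set" where
  "decomps w = {(w1, w2). w1 \<in> L2_I \<and> w2 \<in> H1_I \<and> ae_nondecreasing w1 \<and> ae_nonincreasing w2 \<and>
     (LINT x|leb_I. w2 x) = 0 \<and> (AE x in leb_I. w x = w1 x + w2 x)}"

definition decomposable :: "(real \<Rightarrow> real) set" where
  "decomposable = {w \<in> L2_I. decomps w \<noteq> {}}"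

text \<open>
  The minimizing pair \<open>(w\<^sup>\<up>, w\<^sup>\<down>)\<close>; it is unique up to null sets, and \<open>arg_min\<close> chooses
  representatives.
\<close>

definition opt_decomp :: "(real \<Rightarrow> real) \<Rightarrow> (real \<Rightarrow> real) \<times> (real \<Rightarrow> real)" where
  "opt_decomp w = (ARG_MIN (\<lambda>p. dirichlet (snd p)) p. p \<in> decomps w)"

definition down_part :: "(real \<Rightarrow> real) \<Rightarrow> real \<Rightarrow> real" where
  "down_part w = snd (opt_decomp w)"

definition directed_energy :: "(real \<Rightarrow> real) \<Rightarrow> ereal" where
  "directed_energy w = (if w \<in> decomposable then ereal (dirichlet (down_part w)) else \<infinity>)"

definition subdifferential ::
    "((real \<Rightarrow> real) \<Rightarrow> ereal) \<Rightarrow> (real \<Rightarrow> real) \<Rightarrow> (real \<Rightarrow> real) set" where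
  "subdifferential F w = {\<xi> \<in> L2_I. w \<in> L2_I \<and> F w < \<infinity> \<and>
     (\<forall>v\<in>L2_I. F w + ereal (L2_inner \<xi> (\<lambda>x. v x - w x)) \<le> F v)}"

text \<open>
  Absolute continuity of a curve in \<open>L\<^sup>2(I)\<close>, in the sense used for curves in metric spaces:
  the distance of two values is bounded by the integral of some integrable \<open>m\<close>.
\<close>

definition L2_abs_continuous_on :: "real \<Rightarrow> real \<Rightarrow> (real \<Rightarrow> real \<Rightarrow> real) \<Rightarrow> bool" where
  "L2_abs_continuous_on a b W \<longleftrightarrow> (\<exists>m. set_integrable lborel {a..b} m \<and>
     (\<forall>s t. a \<le> s \<and> s \<le> t \<and> t \<le> b \<longrightarrow> L2_dist (W t) (W s) \<le> (LINT r:{s..t}|lborel. m r)))"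

definition has_L2_deriv :: "(real \<Rightarrow> real \<Rightarrow> real) \<Rightarrow> (real \<Rightarrow> real) \<Rightarrow> real \<Rightarrow> bool" where
  "has_L2_deriv W g t \<longleftrightarrow> g \<in> L2_I \<and>
     ((\<lambda>h. L2_dist (\<lambda>x. (W (t + h) x - W t x) / h) g) \<longlongrightarrow> 0) (at 0)"

text \<open>
  Strong solutions \<open>W : [0,\<infinity>) \<rightarrow> L\<^sup>2(I)\<close> of \<open>W'(t) \<in> - \<partial>\<E>\<^sup>-(W(t))\<close>, \<open>W(0) = w\<close>, in the usual
  class for evolution equations of monotone type: locally absolutely continuous on \<open>(0,\<infinity>)\<close> and
  continuous at \<open>0\<close>.
\<close>

definition gradient_flow :: "(real \<Rightarrow> real) \<Rightarrow> (real \<Rightarrow> real \<Rightarrow> real) \<Rightarrow> bool" where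
  "gradient_flow w W \<longleftrightarrow>
     (\<forall>t\<ge>0. W t \<in> L2_I) \<and>
     (AE x in leb_I. W 0 x = w x) \<and>
     ((\<lambda>t. L2_dist (W t) w) \<longlongrightarrow> 0) (at_right 0) \<and>
     (\<forall>a b. 0 < a \<and> a < b \<longrightarrow> L2_abs_continuous_on a b W) \<and>
     (AE t in lborel. 0 < t \<longrightarrow>
        (\<exists>\<xi> \<in> subdifferential directed_energy (W t). has_L2_deriv W (\<lambda>x. - \<xi> x) t))"

text \<open>
  \<open>is_P t w p\<close> says that \<open>p\<close> represents \<open>P\<^sub>t w\<close>: for \<open>w\<close> in the domain it is the value at time \<open>t\<close>
  of the gradient flow from \<open>w\<close>, otherwise the \<open>L\<^sup>2\<close> limit of such values along initial data
  converging to \<open>w\<close>. It is a relation because \<open>P\<^sub>t w\<close> is determined only up to null sets.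
\<close>

definition is_P :: "real \<Rightarrow> (real \<Rightarrow> real) \<Rightarrow> (real \<Rightarrow> real) \<Rightarrow> bool" where
  "is_P t w p \<longleftrightarrow> w \<in> L2_I \<and> p \<in> L2_I \<and>
     (if w \<in> decomposable
      then \<exists>W. gradient_flow w W \<and> (AE x in leb_I. p x = W t x)
      else \<exists>z W. (\<forall>n::nat. z n \<in> decomposable \<and> gradient_flow (z n) (W n)) \<and>
             (\<lambda>n. L2_dist (z n) w) \<longlonglongrightarrow> 0 \<and> (\<lambda>n. L2_dist (W n t) p) \<longlonglongrightarrow> 0)"

definition is_P_infinity :: "(real \<Rightarrow> real) \<Rightarrow> (real \<Rightarrow> real) \<Rightarrow> bool" where
  "is_P_infinity w v \<longleftrightarrow> v \<in> L2_I \<and>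
     (\<exists>p. (\<forall>t\<ge>0. is_P t w (p t)) \<and> ((\<lambda>t. L2_dist (p t) v) \<longlongrightarrow> 0) at_top)"

definition ess_inf :: "(real \<Rightarrow> real) \<Rightarrow> ereal" where
  "ess_inf f = - esssup leb_I (\<lambda>x. - ereal (f x))"

text \<open>
  The measure \<open>f dx\<close> on \<open>[0,1]\<close>, as a Borel measure on the line vanishing off \<open>I\<close>. Only
  almost everywhere nonnegative \<open>f\<close> are meant; \<open>ennreal\<close> sends negative values to \<open>0\<close>.
\<close>

definition density_measure :: "(real \<Rightarrow> real) \<Rightarrow> real measure" where
  "density_measure f = density lborel (\<lambda>x. ennreal (f x) * indicator I x)"

definition couplings :: "'a measure \<Rightarrow> 'b measure \<Rightarrow> ('a \<times> 'b) measure set" where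
  "couplings \<mu> \<nu> = {\<gamma>. sets \<gamma> = sets (\<mu> \<Otimes>\<^sub>M \<nu>) \<and> distr \<gamma> \<mu> fst = \<mu> \<and> distr \<gamma> \<nu> snd = \<nu>}"

definition W2_squared :: "real measure \<Rightarrow> real measure \<Rightarrow> ennreal" where
  "W2_squared \<mu> \<nu> = (INF \<gamma>\<in>couplings \<mu> \<nu>. \<integral>\<^sup>+ z. ennreal (\<bar>fst z - snd z\<bar>\<^sup>2) \<partial>\<gamma>)"

end

theory Submission
  imports Defs "HOL-Probability.Probability" "HOL-Real_Asymp.Real_Asymp"
begin

text \<open>
  A nondecreasing \<open>z\<close> minimizes the energy, so the \<open>L\<^sup>2\<close> distance to \<open>z\<close> does not increase along the
  flow. Taking for \<open>z\<close> the nondecreasing part of \<open>u\<close> gives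
  \<open>\<parallel>P\<^sub>\<infinity> u - u\<parallel> \<le> 2 \<parallel>u - z\<parallel>\<close>, and \<open>u - z\<close> is the nonincreasing part of \<open>u\<close>, which the Poincare
  inequality bounds by the energy of \<open>u\<close>; no decay rate of the energy is needed. On the other hand,
  comparing horizontal and vertical distances between the graphs of the distribution functions
  \<open>F\<close> and \<open>G\<close> of \<open>u dx\<close> and \<open>P\<^sub>\<infinity> u dx\<close> gives
  \<open>W\<^sub>2\<^sup>2 \<le> (1 / inf u) \<integral> (F - G)\<^sup>2 \<le> (1 / inf u) \<parallel>P\<^sub>\<infinity> u - u\<parallel>\<^sup>2\<close>.
\<close>

section \<open>The Hilbert space of square-integrable functions\<close>

text \<open>The flow is accessible only through its definition: the inclusion holds for almost every
  time and absolute continuity is metric. So monotonicity is derived for scalar functions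
  \<open>\<Phi> (W t)\<close>: a metric modulus bounds their increments, and the subgradient
  inequality, tested at one point whose energy is no larger than that of \<open>W t\<close>, gives
  the sign of their derivative. Such a point exists for two functionals, and one locale serves both.
  The second is there because the transport estimate needs more than an L2 bound: the limit must be
  a probability density. Its sign is controlled because truncation at 0 does not raise the energy,
  its mass by distances to constants. A second obstacle is that the energy is defined through
  \<open>ARG_MIN\<close> and \<open>SOME\<close>. These say nothing until weak derivatives are known
  to be unique and a minimizing decomposition is known to exist. This is what the test functions,
  the completeness of L2 and the stability of monotonicity under limits are for.\<close>

lemma space_leb_I [simp]: "space leb_I = I"
  by (simp add: space_restrict_space)

interpretation leb_I: prob_space leb_I
  by (intro prob_spaceI) (simp add: emeasure_restrict_space)

lemma L2_I_measurable [measurable_dest]: "f \<in> L2_I \<Longrightarrow> f \<in> borel_measurable leb_I"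
  by (simp add: L2_I_def)

lemma L2_I_square: "f \<in> L2_I \<Longrightarrow> integrable leb_I (\<lambda>x. (f x)\<^sup>2)"
  by (simp add: L2_I_def)

lemma L2_I_mult:
  assumes "f \<in> L2_I" "g \<in> L2_I"
  shows "integrable leb_I (\<lambda>x. f x * g x)"
proof (rule Bochner_Integration.integrable_bound)
  show "integrable leb_I (\<lambda>x. (f x)\<^sup>2 + (g x)\<^sup>2)"
    using assms by (intro Bochner_Integration.integrable_add L2_I_square)
  show "(\<lambda>x. f x * g x) \<in> borel_measurable leb_I"
    using assms by (auto intro: L2_I_measurable borel_measurable_times)
  have "\<bar>a * b\<bar> \<le> a\<^sup>2 + b\<^sup>2" for a b :: real
  proof -
    have "2 * \<bar>a * b\<bar> \<le> a\<^sup>2 + b\<^sup>2"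
      using sum_squares_bound[of "\<bar>a\<bar>" "\<bar>b\<bar>"] by (simp add: abs_mult)
    then show ?thesis by simp
  qed
  then show "AE x in leb_I. norm (f x * g x) \<le> norm ((f x)\<^sup>2 + (g x)\<^sup>2)"
    by (auto intro: order.trans)
qed

lemma L2_I_bound:
  assumes "g \<in> L2_I" "f \<in> borel_measurable leb_I" "AE x in leb_I. \<bar>f x\<bar> \<le> \<bar>g x\<bar>"
  shows "f \<in> L2_I"
proof -
  have "integrable leb_I (\<lambda>x. (f x)\<^sup>2)"
  proof (rule Bochner_Integration.integrable_bound[OF L2_I_square[OF assms(1)]])
    show "AE x in leb_I. norm ((f x)\<^sup>2) \<le> norm ((g x)\<^sup>2)"
      using assms(3) by eventually_elim (simp add: abs_le_square_iff)
  qed (use assms(2) in auto)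
  then show ?thesis using assms by (simp add: L2_I_def)
qed

lemma L2_I_const [simp]: "(\<lambda>x. c) \<in> L2_I"
  by (simp add: L2_I_def)

lemma L2_I_add [intro]:
  assumes "f \<in> L2_I" "g \<in> L2_I" shows "(\<lambda>x. f x + g x) \<in> L2_I"
proof -
  have "integrable leb_I (\<lambda>x. (f x)\<^sup>2 + (g x)\<^sup>2 + 2 * (f x * g x))"
    using assms by (intro Bochner_Integration.integrable_add L2_I_square integrable_mult_right L2_I_mult)
  moreover have "(\<lambda>x. f x + g x) \<in> borel_measurable leb_I"
    using assms by (auto intro: L2_I_measurable borel_measurable_add)
  ultimately show ?thesis by (simp add: L2_I_def power2_sum mult.assoc)
qed

lemma L2_I_cmult [intro]: "f \<in> L2_I \<Longrightarrow> (\<lambda>x. c * f x) \<in> L2_I"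
  by (auto simp: L2_I_def power_mult_distrib)

lemma L2_I_uminus [intro]: "f \<in> L2_I \<Longrightarrow> (\<lambda>x. - f x) \<in> L2_I"
  by (auto simp: L2_I_def)

lemma L2_I_diff [intro]: "f \<in> L2_I \<Longrightarrow> g \<in> L2_I \<Longrightarrow> (\<lambda>x. f x - g x) \<in> L2_I"
  using L2_I_add[OF _ L2_I_uminus, of f g] by simp

lemma L2_I_integrable: "f \<in> L2_I \<Longrightarrow> integrable leb_I f"
  using L2_I_mult[of f "\<lambda>x. 1"] by simp

lemma L2_I_max [intro]:
  assumes "f \<in> L2_I" "g \<in> L2_I" shows "(\<lambda>x. max (f x) (g x)) \<in> L2_I"
proof (rule L2_I_bound)
  show "(\<lambda>x. \<bar>f x\<bar> + \<bar>g x\<bar>) \<in> L2_I"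
    using assms by (intro L2_I_add) (auto simp: L2_I_def)
  show "(\<lambda>x. max (f x) (g x)) \<in> borel_measurable leb_I"
    using assms by (auto intro: L2_I_measurable borel_measurable_max)
qed (auto simp: max_def)

lemma L2_norm_nonneg [simp]: "0 \<le> L2_norm f"
  by (simp add: L2_norm_def)

lemma L2_norm_power2: "(L2_norm f)\<^sup>2 = (LINT x|leb_I. (f x)\<^sup>2)"
  by (simp add: L2_norm_def)

lemma L2_norm_le_iff: "0 \<le> c \<Longrightarrow> L2_norm f \<le> c \<longleftrightarrow> (LINT x|leb_I. (f x)\<^sup>2) \<le> c\<^sup>2"
  by (metis L2_norm_nonneg L2_norm_power2 abs_le_square_iff abs_of_nonneg)

lemma L2_norm_minus_commute: "L2_norm (\<lambda>x. f x - g x) = L2_norm (\<lambda>x. g x - f x)"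
  by (simp add: L2_norm_def power2_commute)

lemma L2_norm_cmult: "L2_norm (\<lambda>x. c * f x) = \<bar>c\<bar> * L2_norm f"
  by (simp add: L2_norm_def power_mult_distrib real_sqrt_mult)

lemma L2_norm_cong_AE:
  assumes "f \<in> borel_measurable leb_I" "g \<in> borel_measurable leb_I" "AE x in leb_I. f x = g x"
  shows "L2_norm f = L2_norm g"
  unfolding L2_norm_def using assms by (intro arg_cong[where f = sqrt] integral_cong_AE) auto

lemma L2_inner_commute: "L2_inner f g = L2_inner g f"
  by (simp add: L2_inner_def mult.commute)

lemma L2_inner_diff_right:
  "f \<in> L2_I \<Longrightarrow> g \<in> L2_I \<Longrightarrow> h \<in> L2_I \<Longrightarrow>
    L2_inner f (\<lambda>x. g x - h x) = L2_inner f g - L2_inner f h"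
  by (simp add: L2_inner_def right_diff_distrib L2_I_mult)

lemma L2_inner_cmult_right: "L2_inner f (\<lambda>x. c * g x) = c * L2_inner f g"
  by (simp add: L2_inner_def mult.left_commute)

lemma L2_inner_minus_right: "L2_inner f (\<lambda>x. - g x) = - L2_inner f g"
  by (simp add: L2_inner_def)

lemma L2_norm_add_power2:
  assumes "f \<in> L2_I" "g \<in> L2_I"
  shows "(L2_norm (\<lambda>x. f x + g x))\<^sup>2 = (L2_norm f)\<^sup>2 + 2 * L2_inner f g + (L2_norm g)\<^sup>2"
  using assms by (simp add: L2_norm_power2 L2_inner_def power2_sum mult.assoc L2_I_mult L2_I_square)

text \<open>The squared norm of \<open>f + t g\<close> is a nonnegative quadratic polynomial in
  \<open>t\<close>, so its discriminant is not positive. On representatives \<open>L2_norm\<close>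
  is only a seminorm; \<open>c = 0\<close> does not make \<open>g\<close> the zero function and is a
  separate case.\<close>

lemma L2_Cauchy_Schwarz:
  assumes "f \<in> L2_I" "g \<in> L2_I"
  shows "\<bar>L2_inner f g\<bar> \<le> L2_norm f * L2_norm g"
proof -
  define a b c where "a = (L2_norm f)\<^sup>2" and "b = L2_inner f g" and "c = (L2_norm g)\<^sup>2"
  have quad: "0 \<le> a + 2 * (t * b) + t\<^sup>2 * c" for t
  proof -
    have "(L2_norm (\<lambda>x. f x + t * g x))\<^sup>2 = a + 2 * (t * b) + t\<^sup>2 * c"
      using assms by (subst L2_norm_add_power2)
        (auto simp: L2_inner_cmult_right L2_norm_cmult power_mult_distrib a_def b_def c_def)
    then show ?thesis by (metis zero_le_power2)
  qed
  have "b\<^sup>2 \<le> a * c"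
  proof (cases "c = 0")
    case True
    have "b = 0"
    proof (rule ccontr)
      assume "b \<noteq> 0"
      \<comment> \<open>For \<open>c = 0\<close> the polynomial is affine, and at this
        \<open>t\<close> it equals -1.\<close>
      then show False using quad[of "- (a + 1) / (2 * b)"] True
        by (simp add: a_def add_pos_nonneg field_simps)
    qed
    then show ?thesis using True by simp
  next
    case False
    then have "c > 0" by (simp add: c_def less_le)
    then show ?thesis using quad[of "- b / c"]
      by (simp add: field_simps power2_eq_square)
  qed
  then have "b\<^sup>2 \<le> (L2_norm f * L2_norm g)\<^sup>2" by (simp add: a_def c_def power_mult_distrib)
  then show ?thesis unfolding b_def by (simp add: abs_le_square_iff[symmetric])
qed

lemma L2_norm_triangle:
  assumes "f \<in> L2_I" "g \<in> L2_I"
  shows "L2_norm (\<lambda>x. f x + g x) \<le> L2_norm f + L2_norm g"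
proof (rule power2_le_imp_le)
  show "(L2_norm (\<lambda>x. f x + g x))\<^sup>2 \<le> (L2_norm f + L2_norm g)\<^sup>2"
    using L2_norm_add_power2[OF assms] L2_Cauchy_Schwarz[OF assms]
    by (simp add: power2_sum abs_le_iff)
qed simp

lemma L2_dist_commute: "L2_dist f g = L2_dist g f"
  unfolding L2_dist_def by (rule L2_norm_minus_commute)

lemma L2_dist_nonneg [simp]: "0 \<le> L2_dist f g"
  by (simp add: L2_dist_def)

lemma L2_dist_triangle:
  assumes "f \<in> L2_I" "g \<in> L2_I" "h \<in> L2_I"
  shows "L2_dist f h \<le> L2_dist f g + L2_dist g h"
  using L2_norm_triangle[of "\<lambda>x. f x - g x" "\<lambda>x. g x - h x"] assms
  by (simp add: L2_dist_def L2_I_diff)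

text \<open>Cauchy-Schwarz against the constant 1, which has norm 1 because \<open>I\<close> has
  length one.\<close>

lemma L1_le_L2_norm:
  assumes "f \<in> L2_I"
  shows "(LINT x|leb_I. \<bar>f x\<bar>) \<le> L2_norm f"
proof -
  have abs: "(\<lambda>x. \<bar>f x\<bar>) \<in> L2_I" using assms by (auto simp: L2_I_def)
  have "L2_norm (\<lambda>x. \<bar>f x\<bar>) = L2_norm f" "L2_norm (\<lambda>x. 1) = 1"
    using leb_I.prob_space by (simp_all add: L2_norm_def)
  then show ?thesis
    using L2_Cauchy_Schwarz[OF abs L2_I_const[of 1]] by (simp add: L2_inner_def)
qed

lemma L2_norm_eq_0_AE:
  assumes "f \<in> L2_I" "L2_norm f = 0"
  shows "AE x in leb_I. f x = 0"
proof -
  have "(LINT x|leb_I. (f x)\<^sup>2) = 0" using assms(2) L2_norm_power2[of f] by simp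
  then show ?thesis
    using integral_nonneg_eq_0_iff_AE[OF L2_I_square[OF assms(1)]] by simp
qed

lemma L2_inner_tendsto:
  assumes lim: "((\<lambda>n. L2_dist (f n) F) \<longlongrightarrow> 0) A"
    and "\<And>n. f n \<in> L2_I" "F \<in> L2_I" "g \<in> L2_I"
  shows "((\<lambda>n. L2_inner (f n) g) \<longlongrightarrow> L2_inner F g) A"
proof -
  have "((\<lambda>n. L2_inner (f n) g - L2_inner F g) \<longlongrightarrow> 0) A"
  proof (rule Lim_null_comparison)
    show "\<forall>\<^sub>F n in A. norm (L2_inner (f n) g - L2_inner F g) \<le> L2_dist (f n) F * L2_norm g"
    proof (intro always_eventually allI)
      fix n
      have "L2_inner (f n) g - L2_inner F g = L2_inner g (\<lambda>x. f n x - F x)"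
        using assms by (simp add: L2_inner_commute[of _ g] L2_inner_diff_right)
      then show "norm (L2_inner (f n) g - L2_inner F g) \<le> L2_dist (f n) F * L2_norm g"
        using L2_Cauchy_Schwarz[of g "\<lambda>x. f n x - F x"] assms
        by (simp add: L2_dist_def mult.commute L2_I_diff)
    qed
    show "((\<lambda>n. L2_dist (f n) F * L2_norm g) \<longlongrightarrow> 0) A"
      using tendsto_mult_left_zero[OF lim] by simp
  qed
  then show ?thesis by (simp add: LIM_zero_iff)
qed

section \<open>Bump functions and the fundamental lemma\<close>

lemma leb_I_ident: "(\<lambda>x. x) \<in> leb_I \<rightarrow>\<^sub>M borel"
  by (simp add: measurable_restrict_space1)

section \<open>Functions with vanishing integrals over intervals\<close>

lemma integrable_leb_I_indicator:
  fixes f :: "real \<Rightarrow> real"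
  assumes "integrable leb_I f" "A \<in> sets borel"
  shows "integrable leb_I (\<lambda>x. f x * indicator A x)"
proof (rule Bochner_Integration.integrable_bound[OF assms(1)])
  note leb_I_ident [measurable]
  have [measurable]: "f \<in> borel_measurable leb_I" "A \<in> sets borel" using assms by auto
  show "(\<lambda>x. f x * indicator A x) \<in> borel_measurable leb_I" by measurable
qed (auto split: split_indicator)

text \<open>The positive and the negative part of \<open>h\<close> are densities of two finite
  measures that agree on all half-lines, hence on all Borel sets, so the densities agree a.e. Two
  truncations \<open>ennreal (h x)\<close> and \<open>ennreal (- h x)\<close> can be equal only if
  \<open>h x = 0\<close>.\<close>

lemma AE_eq_0_if_integral_tails_0:
  fixes h :: "real \<Rightarrow> real"
  assumes h: "integrable leb_I h"
    and zero: "\<And>a. (LINT x|leb_I. h x * indicator {a<..} x) = 0"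
  shows "AE x in leb_I. h x = 0"
proof -
  note leb_I_ident [measurable]
  have [measurable]: "h \<in> borel_measurable leb_I" using h by auto
  \<comment> \<open>The push-forward moves the measure from the sigma-algebra of \<open>I\<close> to
    the Borel sets of the line, where half-lines form a generator. Since \<open>ennreal\<close>
    truncates, \<open>M h\<close> has the positive part of \<open>h\<close> as density and
    \<open>M (\<lambda>x. - h x)\<close> the negative part.\<close>
  define M where "M k = distr (density leb_I (\<lambda>x. ennreal (k x))) borel (\<lambda>x. x)" for k :: "real \<Rightarrow> real"
  have em: "emeasure (M k) {a<..} = (\<integral>\<^sup>+x. ennreal (k x * indicator {a<..} x) \<partial>leb_I)"
    if [measurable]: "k \<in> borel_measurable leb_I" for k a
  proof -
    have "emeasure (M k) {a<..} = emeasure (density leb_I (\<lambda>x. ennreal (k x))) ({a<..} \<inter> I)"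
      unfolding M_def by (subst emeasure_distr) (auto simp: vimage_def Int_def)
    also have "\<dots> = (\<integral>\<^sup>+x. ennreal (k x) * indicator ({a<..} \<inter> I) x \<partial>leb_I)"
      by (intro emeasure_density) (auto simp: sets_restrict_space)
    also have "\<dots> = (\<integral>\<^sup>+x. ennreal (k x * indicator {a<..} x) \<partial>leb_I)"
      by (intro nn_integral_cong) (auto split: split_indicator)
    finally show ?thesis .
  qed
  have fin: "(\<integral>\<^sup>+x. ennreal (k x * indicator {a<..} x) \<partial>leb_I) < \<infinity>" if "integrable leb_I k" for k a
  proof -
    have "integrable leb_I (\<lambda>x. k x * indicator {a<..} x)"
      using that by (rule integrable_leb_I_indicator) simp
    then show ?thesis by (simp add: real_integrable_def less_top[symmetric])
  qed
  have eq: "M h = M (\<lambda>x. - h x)"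
  proof (rule measure_eqI_lessThan)
    fix a
    let ?k = "\<lambda>x. h x * indicator {a<..} x"
    have "integrable leb_I ?k"
      using h by (rule integrable_leb_I_indicator) simp
    then have "enn2real (\<integral>\<^sup>+x. ennreal (?k x) \<partial>leb_I) = enn2real (\<integral>\<^sup>+x. ennreal (- ?k x) \<partial>leb_I)"
      using zero[of a] by (simp add: real_lebesgue_integral_def)
    moreover have "(\<integral>\<^sup>+x. ennreal (?k x) \<partial>leb_I) < \<infinity>" "(\<integral>\<^sup>+x. ennreal (- ?k x) \<partial>leb_I) < \<infinity>"
      using fin[OF h, of a] fin[of "\<lambda>x. - h x" a] h by auto
    ultimately have "(\<integral>\<^sup>+x. ennreal (?k x) \<partial>leb_I) = (\<integral>\<^sup>+x. ennreal (- ?k x) \<partial>leb_I)"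
      by (metis ennreal_enn2real infinity_ennreal_def)
    then show "emeasure (M h) {a<..} = emeasure (M (\<lambda>x. - h x)) {a<..}"
      by (simp add: em)
    show "emeasure (M h) {a<..} < \<infinity>" using fin[OF h] by (simp add: em)
  qed (simp_all add: M_def)
  have "density leb_I (\<lambda>x. ennreal (h x)) = density leb_I (\<lambda>x. ennreal (- h x))"
  proof (rule measure_eqI)
    fix A assume "A \<in> sets (density leb_I (\<lambda>x. ennreal (h x)))"
    then have A: "A \<in> sets borel" "A \<subseteq> I" by (auto simp: sets_restrict_space)
    have "emeasure (M k) A = emeasure (density leb_I (\<lambda>x. ennreal (k x))) A"
      if "k \<in> borel_measurable leb_I" for k
      unfolding M_def using A that by (subst emeasure_distr) (auto simp: Int_absorb2)
    from this[of h] this[of "\<lambda>x. - h x"] eq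
    show "emeasure (density leb_I (\<lambda>x. ennreal (h x))) A
        = emeasure (density leb_I (\<lambda>x. ennreal (- h x))) A" by simp
  qed simp
  then have "AE x in leb_I. ennreal (h x) = ennreal (- h x)"
    by (intro leb_I.density_unique) auto
  then show ?thesis
    by eventually_elim (metis ennreal_inj ennreal_neg neg_0_le_iff_le linear order_antisym
        ennreal_0 le_less neg_equal_0_iff_equal ennreal_eq_0_iff)
qed

text \<open>The classical function exp(-1/t), extended by 0 to \<open>t \<le> 0\<close>. The extra
  power in the denominator makes the linear span of the family closed under differentiation.\<close>

definition flat :: "nat \<Rightarrow> real \<Rightarrow> real" where
  "flat k t = (if t \<le> 0 then 0 else exp (- 1 / t) / t ^ k)"

lemma flat_nonneg: "0 \<le> flat k t"
  by (simp add: flat_def)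

lemma flat_0_le_1: "flat 0 t \<le> 1"
  by (simp add: flat_def)

lemma flat_tendsto_0: "(flat k \<longlongrightarrow> 0) (at_right 0)"
proof -
  have "((\<lambda>t. (inverse t) ^ k / exp (inverse t)) \<longlongrightarrow> (0::real)) (at_right 0)"
    by (rule filterlim_compose[OF tendsto_power_div_exp_0 filterlim_inverse_at_top_right])
  moreover have "\<forall>\<^sub>F t in at_right 0. (inverse t) ^ k / exp (inverse t) = flat k t"
    by (rule eventually_at_right_less[THEN eventually_mono])
      (simp add: flat_def exp_minus field_simps)
  ultimately show ?thesis by (rule Lim_transform_eventually)
qed

lemma flat_has_derivative:
  "(flat k has_real_derivative (flat (k + 2) t - k * flat (Suc k) t)) (at t)"
proof (cases t "0 :: real" rule: linorder_cases)
  case less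
  have "((\<lambda>_. 0) has_real_derivative 0) (at t)" by simp
  then have "(flat k has_real_derivative 0) (at t)"
    by (rule has_field_derivative_transform_within_open[where S = "{..<0}"])
      (use less in \<open>auto simp: flat_def\<close>)
  then show ?thesis using less by (simp add: flat_def)
next
  case greater
  have "((\<lambda>t. exp (- 1 / t) / t ^ k) has_real_derivative
      (exp (- 1 / t) / t ^ (k + 2) - k * (exp (- 1 / t) / t ^ Suc k))) (at t)"
  proof (induction k)
    case 0
    then show ?case using greater
      by (auto intro!: derivative_eq_intros simp: field_simps power2_eq_square)
  next
    case (Suc k)
    have d: "((\<lambda>t. exp (- 1 / t) / t ^ k * (1 / t)) has_real_derivative
      (exp (- 1 / t) / t ^ (k + 2) - k * (exp (- 1 / t) / t ^ Suc k)) * (1 / t)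
      + (- 1 / t\<^sup>2) * (exp (- 1 / t) / t ^ k)) (at t)"
      using greater by (intro DERIV_mult Suc)
        (auto intro!: derivative_eq_intros simp: field_simps power2_eq_square)
    have "(\<lambda>t::real. exp (- 1 / t) / t ^ k * (1 / t)) = (\<lambda>t. exp (- 1 / t) / t ^ Suc k)"
      by (simp only: times_divide_times_eq mult_1_right power_Suc2)
    with DERIV_cong[OF d, of "exp (- 1 / t) / t ^ (Suc k + 2) - Suc k * (exp (- 1 / t) / t ^ Suc (Suc k))"]
    show ?case using greater by (simp add: field_simps power2_eq_square)
  qed
  then have "(flat k has_real_derivative
      (exp (- 1 / t) / t ^ (k + 2) - k * (exp (- 1 / t) / t ^ Suc k))) (at t)"
    by (rule has_field_derivative_transform_within_open[where S = "{0<..}"])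
      (use greater in \<open>auto simp: flat_def\<close>)
  then show ?thesis using greater by (simp add: flat_def)
next
  case equal
  \<comment> \<open>At 0 the right difference quotient of \<open>flat k\<close> is
    \<open>flat (Suc k)\<close> itself, which tends to 0; the left one is constantly 0.\<close>
  have "((\<lambda>h. (flat k (0 + h) - flat k 0) / h) \<longlongrightarrow> 0) (at_right 0)"
  proof (rule Lim_transform_eventually[OF flat_tendsto_0[of "Suc k"]])
    show "\<forall>\<^sub>F h in at_right 0. flat (Suc k) h = (flat k (0 + h) - flat k 0) / h"
      by (rule eventually_at_right_less[THEN eventually_mono]) (simp add: flat_def)
  qed
  moreover have "((\<lambda>h. (flat k (0 + h) - flat k 0) / h) \<longlongrightarrow> 0) (at_left 0)"
    by (rule tendsto_eventually) (auto simp: eventually_at_filter flat_def)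
  ultimately have "((\<lambda>h. (flat k (0 + h) - flat k 0) / h) \<longlongrightarrow> 0) (at 0)"
    by (simp add: filterlim_split_at)
  then show ?thesis using equal by (simp add: DERIV_def flat_def)
qed

text \<open>An algebra of functions closed under differentiation. Membership gives derivatives of
  every order at once, so smoothness of a concrete function reduces to writing it with these four
  rules.\<close>

inductive_set smooth_funs :: "(real \<Rightarrow> real) set" where
  const: "(\<lambda>x. c) \<in> smooth_funs"
| flat: "(\<lambda>x. flat k (a * x + b)) \<in> smooth_funs"
| add: "f \<in> smooth_funs \<Longrightarrow> g \<in> smooth_funs \<Longrightarrow> (\<lambda>x. f x + g x) \<in> smooth_funs"
| mult: "f \<in> smooth_funs \<Longrightarrow> g \<in> smooth_funs \<Longrightarrow> (\<lambda>x. f x * g x) \<in> smooth_funs"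

lemma smooth_funs_derivative:
  "f \<in> smooth_funs \<Longrightarrow> \<exists>f'\<in>smooth_funs. \<forall>x. (f has_real_derivative f' x) (at x)"
proof (induction rule: smooth_funs.induct)
  case (const c)
  then show ?case by (intro bexI[of _ "\<lambda>x. 0"]) (auto intro: smooth_funs.intros)
next
  case (flat k a b)
  have "((\<lambda>x. flat k (a * x + b)) has_real_derivative
      (flat (k + 2) (a * x + b) + (- real k) * flat (Suc k) (a * x + b)) * a) (at x)" for x
    by (rule DERIV_chain2[where g = "\<lambda>x. a * x + b", OF _ _])
      (use flat_has_derivative[of k "a * x + b"] in \<open>auto intro!: derivative_eq_intros\<close>)
  moreover have "(\<lambda>x. (flat (k + 2) (a * x + b) + (- real k) * flat (Suc k) (a * x + b)) * a) \<in> smooth_funs"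
    by (intro smooth_funs.intros)
  ultimately show ?case
    by (intro bexI[of _ "\<lambda>x. (flat (k + 2) (a * x + b) + (- real k) * flat (Suc k) (a * x + b)) * a"]) auto
next
  case (add f g)
  then obtain f' g' where *: "f' \<in> smooth_funs" "g' \<in> smooth_funs"
    "\<And>x. (f has_real_derivative f' x) (at x)" "\<And>x. (g has_real_derivative g' x) (at x)" by blast
  then show ?case
    by (intro bexI[of _ "\<lambda>x. f' x + g' x"]) (auto intro!: smooth_funs.intros derivative_eq_intros)
next
  case (mult f g)
  then obtain f' g' where *: "f' \<in> smooth_funs" "g' \<in> smooth_funs"
    "\<And>x. (f has_real_derivative f' x) (at x)" "\<And>x. (g has_real_derivative g' x) (at x)" by blast
  have "((\<lambda>x. f x * g x) has_real_derivative f' x * g x + f x * g' x) (at x)" for x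
    using DERIV_mult[OF *(3)[of x] *(4)[of x]] by (simp add: mult.commute add.commute)
  moreover have "(\<lambda>x. f' x * g x + f x * g' x) \<in> smooth_funs"
    using * mult.hyps by (intro smooth_funs.intros)
  ultimately show ?case by (intro bexI[of _ "\<lambda>x. f' x * g x + f x * g' x"]) auto
qed

lemma smooth_funs_isCont: "f \<in> smooth_funs \<Longrightarrow> isCont f x"
  using smooth_funs_derivative DERIV_isCont by blast

lemma smooth_funs_deriv: "f \<in> smooth_funs \<Longrightarrow> deriv f \<in> smooth_funs"
proof -
  assume "f \<in> smooth_funs"
  then obtain f' where f': "f' \<in> smooth_funs" "\<And>x. (f has_real_derivative f' x) (at x)"
    using smooth_funs_derivative by blast
  then have "deriv f = f'" by (intro ext DERIV_imp_deriv)
  with f' show ?thesis by simp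
qed

lemma smooth_funs_deriv_funpow: "f \<in> smooth_funs \<Longrightarrow> (deriv ^^ n) f \<in> smooth_funs"
  by (induction n) (auto simp: smooth_funs_deriv)

lemma smooth_funs_differentiable_on: "f \<in> smooth_funs \<Longrightarrow> f differentiable_on UNIV"
  using smooth_funs_derivative
  by (force simp: differentiable_on_def has_field_derivative_def differentiable_def)

text \<open>Only the derivative has to lie in \<open>smooth_funs\<close>. This admits
  antiderivatives of members, which need not be members themselves.\<close>

lemma test_functionI:
  assumes d: "\<And>x. (\<phi> has_real_derivative \<psi> x) (at x)" and \<psi>: "\<psi> \<in> smooth_funs"
    and K: "compact K" "K \<subseteq> I" "\<And>x. x \<notin> K \<Longrightarrow> \<phi> x = 0"
  shows "\<phi> \<in> test_functions" "deriv \<phi> = \<psi>"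
proof -
  show eq: "deriv \<phi> = \<psi>" using d by (intro ext DERIV_imp_deriv)
  have "(deriv ^^ n) \<phi> differentiable_on UNIV" for n
  proof (cases n)
    case 0
    then show ?thesis using d
      by (force simp: differentiable_on_def has_field_derivative_def differentiable_def)
  next
    case (Suc m)
    have "(deriv ^^ Suc m) \<phi> = (deriv ^^ m) \<psi>" by (simp only: funpow_Suc_right comp_def eq)
    then show ?thesis using Suc \<psi> smooth_funs_deriv_funpow smooth_funs_differentiable_on by simp
  qed
  then show "\<phi> \<in> test_functions" using K by (auto simp: test_functions_def)
qed

lemma smooth_fun_test_function:
  assumes "\<phi> \<in> smooth_funs" "compact K" "K \<subseteq> I" "\<And>x. x \<notin> K \<Longrightarrow> \<phi> x = 0"
  shows "\<phi> \<in> test_functions"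
proof -
  obtain \<psi> where "\<psi> \<in> smooth_funs" "\<And>x. (\<phi> has_real_derivative \<psi> x) (at x)"
    using smooth_funs_derivative[OF assms(1)] by blast
  then show ?thesis by (intro test_functionI(1)[where K = K] assms(2-4)) auto
qed

text \<open>A smooth approximation of the indicator of the open interval from \<open>a\<close> to
  \<open>b\<close>. The shift by 1 keeps the support in \<open>{a + 1 / n..b - 1 / n}\<close>, which
  is a compact part of \<open>I\<close> even for \<open>a = 0\<close> and
  \<open>b = 1\<close>.\<close>

definition plateau :: "real \<Rightarrow> real \<Rightarrow> nat \<Rightarrow> real \<Rightarrow> real" where
  "plateau a b n x = flat 0 (real n * (x - a) - 1) * flat 0 (real n * (b - x) - 1)"

lemma plateau_smooth: "plateau a b n \<in> smooth_funs"
proof -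
  have "(\<lambda>x. flat 0 (real n * x + (- real n * a - 1)) * flat 0 ((- real n) * x + (real n * b - 1)))
      \<in> smooth_funs"
    by (intro smooth_funs.intros)
  then show ?thesis by (simp add: plateau_def[abs_def] algebra_simps)
qed

lemma plateau_bounds: "0 \<le> plateau a b n x" "plateau a b n x \<le> 1"
  by (simp_all add: plateau_def flat_nonneg flat_0_le_1 mult_le_one)

lemma plateau_eq_0: 
  assumes "0 < n" "x \<notin> {a + 1 / n..b - 1 / n}"
  shows "plateau a b n x = 0"
  using assms by (auto simp: plateau_def flat_def field_simps)

lemma plateau_tendsto: "(\<lambda>n. plateau a b n x) \<longlonglongrightarrow> indicator {a<..<b} x"
proof -
  have lim: "(\<lambda>n. flat 0 (real n * t - 1)) \<longlonglongrightarrow> (if 0 < t then 1 else 0)" for t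
  proof (cases "0 < t")
    case True
    have top: "filterlim (\<lambda>n. real n * t - 1) at_top sequentially"
      using True by real_asymp
    have "(\<lambda>n. exp (- 1 / (real n * t - 1))) \<longlonglongrightarrow> exp 0"
      using tendsto_divide_0[OF tendsto_const filterlim_at_top_imp_at_infinity[OF top]]
      by (intro tendsto_exp) 
    moreover have "\<forall>\<^sub>F n in sequentially. exp (- 1 / (real n * t - 1)) = flat 0 (real n * t - 1)"
      using filterlim_at_top_dense[THEN iffD1, OF top, rule_format, of 0]
      by eventually_elim (simp add: flat_def)
    ultimately show ?thesis using True by (auto intro: Lim_transform_eventually)
  next
    case False
    then have "real n * t \<le> 0" for n by (simp add: mult_nonneg_nonpos)
    then have "flat 0 (real n * t - 1) = 0" for n using order.trans[of "real n * t" 0 1 for n] by (simp add: flat_def)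
    then show ?thesis using False by simp
  qed
  have "(\<lambda>n. plateau a b n x) \<longlonglongrightarrow> (if 0 < x - a then 1 else 0) * (if 0 < b - x then 1 else 0)"
    unfolding plateau_def by (intro tendsto_mult lim)
  then show ?thesis by (simp add: indicator_def split: if_splits)
qed

lemma smooth_funs_borel [measurable_dest]: "f \<in> smooth_funs \<Longrightarrow> f \<in> borel_measurable leb_I"
  by (intro measurable_restrict_space1)
    (auto intro!: borel_measurable_continuous_onI continuous_at_imp_continuous_on smooth_funs_isCont)

lemma integral_plateau_tendsto:
  fixes f :: "real \<Rightarrow> real"
  assumes "integrable leb_I f"
  shows "(\<lambda>n. LINT x|leb_I. f x * plateau a b n x) \<longlonglongrightarrow> (LINT x|leb_I. f x * indicator {a<..<b} x)"
proof (rule integral_dominated_convergence[where w = "\<lambda>x. \<bar>f x\<bar>"])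
  note leb_I_ident [measurable]
  have [measurable]: "f \<in> borel_measurable leb_I" using assms by auto
  show "(\<lambda>x. f x * indicator {a<..<b} x) \<in> borel_measurable leb_I" by measurable
  show "(\<lambda>x. f x * plateau a b n x) \<in> borel_measurable leb_I" for n
    using smooth_funs_borel[OF plateau_smooth] by measurable
  show "AE x in leb_I. (\<lambda>n. f x * plateau a b n x) \<longlonglongrightarrow> f x * indicator {a<..<b} x"
    by (intro AE_I2 tendsto_mult tendsto_const plateau_tendsto)
  show "AE x in leb_I. norm (f x * plateau a b n x) \<le> \<bar>f x\<bar>" for n
    by (intro AE_I2) (simp add: abs_mult plateau_bounds mult_left_le)
qed (use assms in auto)

lemma AE_eq_0_if_integral_intervals_0:
  fixes h :: "real \<Rightarrow> real"
  assumes h: "integrable leb_I h"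
    and zero: "\<And>a b. 0 \<le> a \<Longrightarrow> a < b \<Longrightarrow> b \<le> 1 \<Longrightarrow> (LINT x|leb_I. h x * indicator {a<..<b} x) = 0"
  shows "AE x in leb_I. h x = 0"
proof (rule AE_eq_0_if_integral_tails_0[OF h])
  fix a :: real
  show "(LINT x|leb_I. h x * indicator {a<..} x) = 0"
  proof (cases "a < 1")
    case True
    have "(LINT x|leb_I. h x * indicator {a<..} x) = (LINT x|leb_I. h x * indicator {max a 0<..<1} x)"
      by (intro Bochner_Integration.integral_cong) (auto split: split_indicator)
    with True zero[of "max a 0" 1] show ?thesis by simp
  next
    case False
    then have "(LINT x|leb_I. h x * indicator {a<..} x) = (LINT x|leb_I. 0)"
      by (intro Bochner_Integration.integral_cong) (auto split: split_indicator)
    then show ?thesis by simp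
  qed
qed

text \<open>Plateaus are test functions, and in the limit they turn the hypothesis into vanishing
  integrals over intervals. The lemma makes weak derivatives unique up to null sets.\<close>

lemma fundamental_lemma:
  assumes g: "integrable leb_I g" and zero: "\<And>\<phi>. \<phi> \<in> test_functions \<Longrightarrow> (LINT x|leb_I. g x * \<phi> x) = 0"
  shows "AE x in leb_I. g x = 0"
proof (rule AE_eq_0_if_integral_intervals_0[OF g])
  fix a b :: real assume ab: "0 \<le> a" "a < b" "b \<le> 1"
  have "(LINT x|leb_I. g x * plateau a b n x) = 0" if n: "0 < n" for n
  proof (rule zero, rule smooth_fun_test_function[OF plateau_smooth])
    have "0 < 1 / real n" using n by simp
    then show "{a + 1 / n..b - 1 / n} \<subseteq> I" using ab by (auto simp del: zero_less_divide_1_iff)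
  qed (use n in \<open>auto intro: plateau_eq_0\<close>)
  then have "\<forall>\<^sub>F n in sequentially. (LINT x|leb_I. g x * plateau a b n x) = 0"
    by (auto intro: eventually_mono[OF eventually_gt_at_top[of 0]])
  then have "(\<lambda>n. LINT x|leb_I. g x * plateau a b n x) \<longlonglongrightarrow> 0" by (rule tendsto_eventually)
  then show "(LINT x|leb_I. g x * indicator {a<..<b} x) = 0"
    using integral_plateau_tendsto[OF g] LIMSEQ_unique by blast
qed

section \<open>Weak derivatives and the Poincare inequality\<close>

lemma test_function_has_derivative:
  assumes "\<phi> \<in> test_functions"
  shows "(\<phi> has_real_derivative deriv \<phi> x) (at x)"
proof -
  have "\<phi> differentiable_on UNIV"
    using assms by (auto simp: test_functions_def dest: spec[of _ 0])
  then show ?thesis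
    by (simp add: differentiable_on_def DERIV_deriv_iff_real_differentiable)
qed

lemma test_function_isCont: "\<phi> \<in> test_functions \<Longrightarrow> isCont \<phi> x"
  using test_function_has_derivative DERIV_isCont by blast

lemma test_function_isCont_deriv:
  assumes "\<phi> \<in> test_functions"
  shows "isCont (deriv \<phi>) x"
proof -
  have "deriv \<phi> differentiable_on UNIV"
    using assms by (auto simp: test_functions_def dest: spec[of _ 1])
  then show ?thesis
    by (simp add: differentiable_on_def differentiable_imp_continuous_within)
qed

lemma test_function_boundary:
  assumes "\<phi> \<in> test_functions" "x \<notin> I"
  shows "\<phi> x = 0"
  using assms by (auto simp: test_functions_def)

lemma continuous_L2_I:
  assumes "\<And>x. isCont f x"
  shows "f \<in> L2_I"
proof -
  have "continuous_on {0..1} f" using assms by (simp add: continuous_at_imp_continuous_on)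
  then have "compact (f ` {0..1})" by (rule compact_continuous_image) simp
  then obtain B where B: "\<And>x. x \<in> {0..1} \<Longrightarrow> norm (f x) \<le> B"
    using compact_imp_bounded bounded_iff by (metis imageI)
  show ?thesis
  proof (rule L2_I_bound[OF L2_I_const[of B]])
    show "f \<in> borel_measurable leb_I" using assms
      by (intro measurable_restrict_space1) (auto intro!: borel_measurable_continuous_onI continuous_at_imp_continuous_on)
    show "AE x in leb_I. \<bar>f x\<bar> \<le> \<bar>B\<bar>"
    proof (rule AE_I2)
      fix x assume "x \<in> space leb_I"
      then have "norm (f x) \<le> B" by (intro B) auto
      then show "\<bar>f x\<bar> \<le> \<bar>B\<bar>" by simp
    qed
  qed
qed

lemma test_function_L2_I: "\<phi> \<in> test_functions \<Longrightarrow> \<phi> \<in> L2_I"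
  by (simp add: continuous_L2_I test_function_isCont)

lemma deriv_test_function_L2_I: "\<phi> \<in> test_functions \<Longrightarrow> deriv \<phi> \<in> L2_I"
  by (simp add: continuous_L2_I test_function_isCont_deriv)

lemma integral_leb_I_FTC:
  fixes f :: "real \<Rightarrow> real"
  assumes "\<And>x. (F has_real_derivative f x) (at x)" "\<And>x. isCont f x" "0 \<le> y" "y \<le> 1"
  shows "(LINT x|leb_I. f x * indicator {y<..} x) = F 1 - F y"
proof -
  have "(LINT x|leb_I. f x * indicator {y<..} x) = (LINT x|lborel. indicator I x * (f x * indicator {y<..} x))"
    by (subst integral_restrict_space) auto
  also have "\<dots> = (LINT x|lborel. f x * indicator {y..1} x)"
  proof (rule integral_cong_AE)
    have [measurable]: "f \<in> borel_measurable borel"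
      using assms by (auto intro!: borel_measurable_continuous_onI continuous_at_imp_continuous_on)
    show "(\<lambda>x. indicator I x * (f x * indicator {y<..} x)) \<in> borel_measurable lborel" by measurable
    show "(\<lambda>x. f x * indicator {y..1} x) \<in> borel_measurable lborel" by measurable
    show "AE x in lborel. indicator I x * (f x * indicator {y<..} x) = f x * indicator {y..1} x"
      using AE_lborel_singleton[of y] AE_lborel_singleton[of 1]
      by eventually_elim (use assms in \<open>auto split: split_indicator\<close>)
  qed
  also have "\<dots> = F 1 - F y"
    using assms by (intro integral_FTC_Icc_real) auto
  finally show ?thesis .
qed

lemma leb_I_pair_indicator [measurable]:
  "(\<lambda>z. indicator {..<fst z} (snd z) :: real) \<in> borel_measurable (leb_I \<Otimes>\<^sub>M leb_I)"
proof -
  have [measurable]: "fst \<in> borel_measurable (leb_I \<Otimes>\<^sub>M leb_I)" "snd \<in> borel_measurable (leb_I \<Otimes>\<^sub>M leb_I)"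
    using measurable_compose[OF measurable_fst leb_I_ident] measurable_compose[OF measurable_snd leb_I_ident]
    by auto
  have "(\<lambda>z. if snd z < fst z then 1 else 0 :: real) \<in> borel_measurable (leb_I \<Otimes>\<^sub>M leb_I)"
    by measurable
  then show ?thesis by (simp add: indicator_def)
qed

text \<open>The antiderivative vanishing at 0. Writing the upper limit as an indicator makes it an
  integral over all of \<open>I\<close>, to which Fubini's theorem applies directly.\<close>

definition prim :: "(real \<Rightarrow> real) \<Rightarrow> real \<Rightarrow> real" where
  "prim g x = (LINT y|leb_I. g y * indicator {..<x} y)"

lemma prim_measurable [measurable]:
  assumes [measurable]: "g \<in> borel_measurable leb_I"
  shows "prim g \<in> borel_measurable leb_I"
proof -
  show ?thesis unfolding prim_def[abs_def]
    by (rule leb_I.borel_measurable_lebesgue_integral) measurable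
qed

lemma prim_diff_le:
  assumes g: "integrable leb_I g"
  shows "\<bar>prim g x - prim g y\<bar> \<le> (LINT z|leb_I. \<bar>g z\<bar>)"
proof -
  have "prim g x - prim g y = (LINT z|leb_I. g z * indicator {..<x} z - g z * indicator {..<y} z)"
    unfolding prim_def using g by (intro Bochner_Integration.integral_diff[symmetric] integrable_leb_I_indicator) auto
  also have "\<bar>\<dots>\<bar> \<le> (LINT z|leb_I. \<bar>g z * indicator {..<x} z - g z * indicator {..<y} z\<bar>)"
    by (rule integral_abs_bound)
  also have "\<dots> \<le> (LINT z|leb_I. \<bar>g z\<bar>)"
    using g by (intro integral_mono integrable_abs Bochner_Integration.integrable_diff integrable_leb_I_indicator)
      (auto split: split_indicator)
  finally show ?thesis .
qed

lemma prim_L2_I: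
  assumes g: "integrable leb_I g"
  shows "prim g \<in> L2_I"
proof (rule L2_I_bound[OF L2_I_const[of "LINT z|leb_I. \<bar>g z\<bar>"]])
  show "prim g \<in> borel_measurable leb_I" using g by (intro prim_measurable) auto
  have "prim g 0 = (LINT y|leb_I. 0)"
    unfolding prim_def by (intro Bochner_Integration.integral_cong) auto
  then have "\<bar>prim g x\<bar> \<le> (LINT z|leb_I. \<bar>g z\<bar>)" for x
    using prim_diff_le[OF g, of x 0] by simp
  then show "AE x in leb_I. \<bar>prim g x\<bar> \<le> \<bar>LINT z|leb_I. \<bar>g z\<bar>\<bar>"
    by (intro AE_I2 order.trans[OF _ abs_ge_self])
qed

text \<open>After exchanging the integrals, the inner one is the integral of
  \<open>deriv \<phi>\<close> from \<open>y\<close> to 1, which is \<open>- \<phi> y\<close> since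
  \<open>\<phi>\<close> vanishes at 1.\<close>

lemma prim_by_parts:
  assumes g: "integrable leb_I g" and \<phi>: "\<phi> \<in> test_functions"
  shows "(LINT x|leb_I. prim g x * deriv \<phi> x) = - (LINT x|leb_I. g x * \<phi> x)"
proof -
  interpret P: pair_sigma_finite leb_I leb_I ..
  have [measurable]: "g \<in> borel_measurable leb_I" using g by auto
  have d\<phi>: "integrable leb_I (deriv \<phi>)"
    using \<phi> by (intro L2_I_integrable deriv_test_function_L2_I)
  then have [measurable]: "deriv \<phi> \<in> borel_measurable leb_I" by auto
  let ?f = "\<lambda>x y. g y * indicator {..<x} y * deriv \<phi> x"
  have "integrable (leb_I \<Otimes>\<^sub>M leb_I) (\<lambda>z. deriv \<phi> (fst z) * g (snd z))"
  proof (rule P.Fubini_integrable)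
    show "integrable leb_I (\<lambda>x. LINT y|leb_I. norm (deriv \<phi> (fst (x, y)) * g (snd (x, y))))"
      using d\<phi> by (simp add: abs_mult)
  qed (use g in auto)
  then have int: "integrable (leb_I \<Otimes>\<^sub>M leb_I) (case_prod ?f)"
  proof (rule Bochner_Integration.integrable_bound)
    show "case_prod ?f \<in> borel_measurable (leb_I \<Otimes>\<^sub>M leb_I)"
      unfolding split_beta' by measurable
  qed (auto simp: split_beta' abs_mult indicator_def mult.commute)
  have "(LINT x|leb_I. prim g x * deriv \<phi> x) = (LINT x|leb_I. LINT y|leb_I. ?f x y)"
    unfolding prim_def by simp
  also have "\<dots> = (LINT y|leb_I. LINT x|leb_I. ?f x y)"
    using P.Fubini_integral[OF int] by simp
  also have "\<dots> = (LINT y|leb_I. - (g y * \<phi> y))"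
  proof (rule Bochner_Integration.integral_cong)
    fix y assume "y \<in> space leb_I"
    then have y: "0 \<le> y" "y \<le> 1" by auto
    have "(LINT x|leb_I. ?f x y) = (LINT x|leb_I. g y * (deriv \<phi> x * indicator {y<..} x))"
      by (intro Bochner_Integration.integral_cong) (auto split: split_indicator)
    also have "\<dots> = g y * (\<phi> 1 - \<phi> y)"
      using integral_leb_I_FTC[OF test_function_has_derivative test_function_isCont_deriv y] \<phi> by simp
    finally show "(LINT x|leb_I. ?f x y) = - (g y * \<phi> y)"
      using test_function_boundary[OF \<phi>, of 1] by simp
  qed simp
  finally show ?thesis by simp
qed

text \<open>The antiderivative from 0 vanishes to the left of the support of \<open>\<psi>\<close>;
  zero mean is what makes it vanish to the right as well.\<close>

lemma antiderivative_test_function: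
  assumes \<psi>: "\<psi> \<in> smooth_funs" and zero: "(LINT x|leb_I. \<psi> x) = 0"
    and supp: "0 < c" "d < 1" "\<And>x. x \<notin> {c..d} \<Longrightarrow> \<psi> x = 0"
  obtains \<phi> where "\<phi> \<in> test_functions" "deriv \<phi> = \<psi>"
proof -
  define \<phi> where "\<phi> x = (LBINT y=0..ereal x. \<psi> y)" for x
  have cont: "isCont \<psi> x" for x using \<psi> by (rule smooth_funs_isCont)
  have d: "(\<phi> has_real_derivative \<psi> x) (at x)" for x
  proof -
    have "(\<phi> has_vector_derivative \<psi> x) (at x within {min 0 x - 1..max 0 x + 1})"
      unfolding \<phi>_def using cont 
      by (intro interval_integral_FTC2[of "min 0 x - 1" 0 "max 0 x + 1" \<psi> x, unfolded zero_ereal_def[symmetric]])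
        (auto simp: continuous_at_imp_continuous_on)
    moreover have "at x within {min 0 x - 1..max 0 x + 1} = at x"
      by (intro at_within_Icc_at) auto
    ultimately show ?thesis
      by (simp only: has_real_derivative_iff_has_vector_derivative)
  qed
  have 0: "\<phi> 0 = 0" by (simp add: \<phi>_def zero_ereal_def)
  have "(LINT x|leb_I. \<psi> x * indicator {0<..} x) = \<phi> 1 - \<phi> 0"
    using d cont by (intro integral_leb_I_FTC) auto
  moreover have "(LINT x|leb_I. \<psi> x * indicator {0<..} x) = (LINT x|leb_I. \<psi> x)"
    by (intro Bochner_Integration.integral_cong) auto
  ultimately have 1: "\<phi> 1 = 0" using zero 0 by simp
  have const: "\<phi> x = \<phi> y" if "x < y" "\<And>z. x < z \<Longrightarrow> z < y \<Longrightarrow> \<psi> z = 0" for x y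
  proof (rule DERIV_isconst_end[symmetric, OF that(1)])
    show "continuous_on {x..y} \<phi>"
      using d DERIV_isCont by (intro continuous_at_imp_continuous_on) blast
    show "DERIV \<phi> z :> 0" if "x < z" "z < y" for z
      using d[of z] \<open>\<And>z. x < z \<Longrightarrow> z < y \<Longrightarrow> \<psi> z = 0\<close>[OF that] by simp
  qed
  have "\<phi> x = 0" if x: "x \<notin> {c..d}" for x
  proof -
    consider "x = 0 \<or> x = 1" | "x < 0" | "0 < x" "x < c" | "d < x" "x < 1" | "1 < x"
      using x by (cases "x < 0"; cases "x < c"; cases "x < 1"; simp; linarith)
    then show ?thesis
    proof cases
      case 1 then show ?thesis using 0 \<open>\<phi> 1 = 0\<close> by auto
    next
      case 2 then show ?thesis using const[of x 0] supp 0 by simp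
    next
      case 3 then show ?thesis using const[of 0 x] supp 0 by simp
    next
      case 4 then show ?thesis using const[of x 1] supp \<open>\<phi> 1 = 0\<close> by simp
    next
      case 5 then show ?thesis using const[of 1 x] supp \<open>\<phi> 1 = 0\<close> by simp
    qed
  qed
  then show ?thesis
    using that[of \<phi>] test_functionI[OF d \<psi>, of "{c..d}"] supp(1,2) by (simp add: subset_eq)
qed

text \<open>The integral of \<open>e\<close> over an interval is compared with the length of the
  interval times the mean of \<open>e\<close>. A plateau over the interval is not the derivative of
  a test function, but it becomes one after subtracting the multiple of a plateau over
  \<open>I\<close> that cancels its mean.\<close>

lemma du_Bois_Reymond:
  assumes e: "integrable leb_I e"
    and zero: "\<And>\<phi>. \<phi> \<in> test_functions \<Longrightarrow> (LINT x|leb_I. e x * deriv \<phi> x) = 0"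
  shows "AE x in leb_I. e x = (LINT y|leb_I. e y)"
proof -
  define m where "m = (LINT y|leb_I. e y)"
  have "AE x in leb_I. e x - m = 0"
  proof (rule AE_eq_0_if_integral_intervals_0)
    show "integrable leb_I (\<lambda>x. e x - m)" using e by simp
    fix a b :: real assume ab: "0 \<le> a" "a < b" "b \<le> 1"
    have int1: "(\<lambda>n. LINT x|leb_I. plateau a b n x) \<longlonglongrightarrow> (LINT x|leb_I. indicator {a<..<b} x)" for a b
      using integral_plateau_tendsto[of "\<lambda>x. 1" a b] by simp
    have "(LINT x|leb_I. indicator I x) = (LINT x|leb_I. 1 :: real)"
      by (intro Bochner_Integration.integral_cong) auto
    then have one: "(\<lambda>n. LINT x|leb_I. plateau 0 1 n x) \<longlonglongrightarrow> 1"
      using int1[of 0 1] leb_I.prob_space by simp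
    \<comment> \<open>The weight that gives \<open>?\<psi>\<close> below mean zero. It tends to the
      length of the interval, because the denominator tends to 1.\<close>
    define k where "k n = (LINT x|leb_I. plateau a b n x) / (LINT x|leb_I. plateau 0 1 n x)" for n
    have k: "k \<longlonglongrightarrow> (LINT x|leb_I. indicator {a<..<b} x)"
      unfolding k_def[abs_def] using tendsto_divide[OF int1[of a b] one] by simp
    have ip: "integrable leb_I (plateau a b n)" for a b n
      by (intro L2_I_integrable continuous_L2_I smooth_funs_isCont plateau_smooth)
    have eip: "integrable leb_I (\<lambda>x. e x * plateau a b n x)" for a b n
    proof (rule Bochner_Integration.integrable_bound[OF e])
      show "(\<lambda>x. e x * plateau a b n x) \<in> borel_measurable leb_I"
        using e ip by (intro borel_measurable_times) auto
    qed (auto simp: abs_mult plateau_bounds mult_left_le)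
    have lim: "(\<lambda>n. (LINT x|leb_I. e x * plateau a b n x) - k n * (LINT x|leb_I. e x * plateau 0 1 n x))
        \<longlonglongrightarrow> (LINT x|leb_I. e x * indicator {a<..<b} x) - (LINT x|leb_I. indicator {a<..<b} x) * (LINT x|leb_I. e x * indicator I x)"
      using e by (intro tendsto_diff tendsto_mult k integral_plateau_tendsto)
    \<comment> \<open>The denominator of \<open>k n\<close> is known to be nonzero only for large
      \<open>n\<close>, which is enough for the limit.\<close>
    have ev: "\<forall>\<^sub>F n in sequentially. 0 < (LINT x|leb_I. plateau 0 1 n x)"
      using order_tendstoD(1)[OF one, of 0] by simp
    have "\<forall>\<^sub>F n in sequentially. (LINT x|leb_I. e x * plateau a b n x) - k n * (LINT x|leb_I. e x * plateau 0 1 n x) = 0"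
      using ev eventually_gt_at_top[of 0]
    proof eventually_elim
      fix n :: nat assume pos: "0 < (LINT x|leb_I. plateau 0 1 n x)" and n: "0 < n"
      let ?\<psi> = "\<lambda>x. plateau a b n x + (- k n) * plateau 0 1 n x"
      have n': "0 < 1 / real n" using n by simp
      obtain \<phi> where \<phi>: "\<phi> \<in> test_functions" "deriv \<phi> = ?\<psi>"
      proof (rule antiderivative_test_function)
        show "?\<psi> \<in> smooth_funs" by (intro smooth_funs.intros plateau_smooth)
        show "(LINT x|leb_I. ?\<psi> x) = 0" using pos ip by (simp add: k_def)
        show "0 < 1 / real n" "1 - 1 / real n < 1" using n' by auto
        show "?\<psi> x = 0" if "x \<notin> {1 / real n..1 - 1 / real n}" for x
          using that plateau_eq_0[OF n, of x a b] plateau_eq_0[OF n, of x 0 1] ab by force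
      qed
      have "0 = (LINT x|leb_I. e x * ?\<psi> x)" using zero[OF \<phi>(1)] \<phi>(2) by simp
      also have "\<dots> = (LINT x|leb_I. e x * plateau a b n x - k n * (e x * plateau 0 1 n x))"
        by (simp add: algebra_simps)
      also have "\<dots> = (LINT x|leb_I. e x * plateau a b n x) - k n * (LINT x|leb_I. e x * plateau 0 1 n x)"
        using eip by simp
      finally show "(LINT x|leb_I. e x * plateau a b n x) - k n * (LINT x|leb_I. e x * plateau 0 1 n x) = 0" ..
    qed
    then have "(\<lambda>n. (LINT x|leb_I. e x * plateau a b n x) - k n * (LINT x|leb_I. e x * plateau 0 1 n x)) \<longlonglongrightarrow> 0"
      by (rule tendsto_eventually)
    from LIMSEQ_unique[OF lim this]
    have *: "(LINT x|leb_I. e x * indicator {a<..<b} x) = (LINT x|leb_I. indicator {a<..<b} x) * (LINT x|leb_I. e x * indicator I x)"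
      by simp
    have "(LINT x|leb_I. e x * indicator I x) = m"
      unfolding m_def by (intro Bochner_Integration.integral_cong) auto
    with * have "(LINT x|leb_I. e x * indicator {a<..<b} x) = m * (LINT x|leb_I. indicator {a<..<b} x)" by simp
    then show "(LINT x|leb_I. (e x - m) * indicator {a<..<b} x) = 0"
      using e integrable_leb_I_indicator[OF e, of "{a<..<b}"] integrable_leb_I_indicator[of "\<lambda>x. 1" "{a<..<b}"]
      by (simp add: left_diff_distrib)
  qed
  then show ?thesis by (simp add: m_def)
qed


section \<open>Calculus of weak derivatives\<close>

lemma is_weak_deriv_L2_I: "is_weak_deriv f g \<Longrightarrow> f \<in> L2_I" "is_weak_deriv f g \<Longrightarrow> g \<in> L2_I"
  by (simp_all add: is_weak_deriv_def)

lemma is_weak_derivD: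
  "is_weak_deriv f g \<Longrightarrow> \<phi> \<in> test_functions \<Longrightarrow> L2_inner f (deriv \<phi>) = - L2_inner g \<phi>"
  by (simp add: is_weak_deriv_def L2_inner_def)

lemma is_weak_derivI:
  assumes "f \<in> L2_I" "g \<in> L2_I"
    "\<And>\<phi>. \<phi> \<in> test_functions \<Longrightarrow> L2_inner f (deriv \<phi>) = - L2_inner g \<phi>"
  shows "is_weak_deriv f g"
  using assms by (simp add: is_weak_deriv_def L2_inner_def)

lemma L2_inner_linear_left:
  assumes "f \<in> L2_I" "g \<in> L2_I" "h \<in> L2_I"
  shows "L2_inner (\<lambda>x. a * f x + b * g x) h = a * L2_inner f h + b * L2_inner g h"
  using assms by (simp add: L2_inner_def distrib_right mult.assoc L2_I_mult)

lemma is_weak_deriv_linear: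
  assumes "is_weak_deriv f f'" "is_weak_deriv g g'"
  shows "is_weak_deriv (\<lambda>x. a * f x + b * g x) (\<lambda>x. a * f' x + b * g' x)"
proof (rule is_weak_derivI)
  note L2 = is_weak_deriv_L2_I[OF assms(1)] is_weak_deriv_L2_I[OF assms(2)]
  show "(\<lambda>x. a * f x + b * g x) \<in> L2_I" "(\<lambda>x. a * f' x + b * g' x) \<in> L2_I"
    using L2 by (auto intro!: L2_I_add L2_I_cmult)
  fix \<phi> assume \<phi>: "\<phi> \<in> test_functions"
  then show "L2_inner (\<lambda>x. a * f x + b * g x) (deriv \<phi>) = - L2_inner (\<lambda>x. a * f' x + b * g' x) \<phi>"
    using L2 assms by (simp add: L2_inner_linear_left test_function_L2_I deriv_test_function_L2_I is_weak_derivD)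
qed

lemma is_weak_deriv_unique:
  assumes "is_weak_deriv f g" "is_weak_deriv f g'"
  shows "AE x in leb_I. g x = g' x"
proof -
  note L2 = is_weak_deriv_L2_I(2)[OF assms(1)] is_weak_deriv_L2_I(2)[OF assms(2)]
  have "AE x in leb_I. 1 * g x + (- 1) * g' x = 0"
  proof (rule fundamental_lemma)
    show "integrable leb_I (\<lambda>x. 1 * g x + (- 1) * g' x)"
      using L2 by (intro L2_I_integrable L2_I_add L2_I_cmult)
    fix \<phi> assume \<phi>: "\<phi> \<in> test_functions"
    have "L2_inner (\<lambda>x. 1 * g x + (- 1) * g' x) \<phi> = 0"
      using L2 \<phi> assms[THEN is_weak_derivD, OF \<phi>]
      by (subst L2_inner_linear_left) (simp_all add: test_function_L2_I)
    then show "(LINT x|leb_I. (1 * g x + (- 1) * g' x) * \<phi> x) = 0" by (simp add: L2_inner_def)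
  qed
  then show ?thesis by simp
qed

lemma weak_deriv_is_weak_deriv: "f \<in> H1_I \<Longrightarrow> is_weak_deriv f (weak_deriv f)"
  by (simp add: H1_I_def weak_deriv_def someI_ex)

text \<open>Makes the choice hidden in \<open>weak_deriv\<close> harmless: any weak derivative at
  hand computes the energy.\<close>

lemma dirichlet_eq:
  assumes "is_weak_deriv f g"
  shows "dirichlet f = 1/2 * (L2_norm g)\<^sup>2"
proof -
  have *: "is_weak_deriv f (weak_deriv f)"
    using assms by (intro weak_deriv_is_weak_deriv) (auto simp: H1_I_def)
  have "L2_norm (weak_deriv f) = L2_norm g"
    using is_weak_deriv_L2_I(2)[OF *] is_weak_deriv_L2_I(2)[OF assms]
    by (intro L2_norm_cong_AE is_weak_deriv_unique[OF * assms] L2_I_measurable)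
  then show ?thesis by (simp add: dirichlet_def L2_norm_power2[symmetric])
qed

lemma dirichlet_nonneg [simp]: "0 \<le> dirichlet f"
  by (simp add: dirichlet_def)

text \<open>\<open>f\<close> is an antiderivative of \<open>g\<close> minus its mean, and an
  antiderivative oscillates by at most the L1 norm of \<open>g\<close>. This bounds \<open>f\<close>
  even uniformly, with the simple constant 1.\<close>

lemma Poincare_inequality:
  assumes fg: "is_weak_deriv f g" and mean: "(LINT x|leb_I. f x) = 0"
  shows "L2_norm f \<le> L2_norm g"
proof -
  have f: "f \<in> L2_I" and g: "g \<in> L2_I" using is_weak_deriv_L2_I[OF fg] by auto
  have ig: "integrable leb_I g" using g by (rule L2_I_integrable)
  have h: "prim g \<in> L2_I" by (rule prim_L2_I[OF ig])
  have ih: "integrable leb_I (prim g)" using h by (rule L2_I_integrable)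
  define m where "m = (LINT x|leb_I. prim g x)"
  \<comment> \<open>\<open>f\<close> and \<open>prim g\<close> have the same weak derivative, so
    they differ by a constant; as \<open>f\<close> has mean zero, that constant is
    \<open>- m\<close>.\<close>
  have "AE x in leb_I. f x - prim g x = (LINT y|leb_I. f y - prim g y)"
  proof (rule du_Bois_Reymond)
    show "integrable leb_I (\<lambda>x. f x - prim g x)" using f h by (intro L2_I_integrable L2_I_diff)
    fix \<phi> assume \<phi>: "\<phi> \<in> test_functions"
    have "L2_inner (prim g) (deriv \<phi>) = - L2_inner g \<phi>"
      using prim_by_parts[OF ig \<phi>] by (simp add: L2_inner_def)
    then have "L2_inner (\<lambda>x. 1 * f x + (- 1) * prim g x) (deriv \<phi>) = 0"
      using is_weak_derivD[OF fg \<phi>] f h deriv_test_function_L2_I[OF \<phi>]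
      by (subst L2_inner_linear_left) simp_all
    then show "(LINT x|leb_I. (f x - prim g x) * deriv \<phi> x) = 0" by (simp add: L2_inner_def)
  qed
  then have repr: "AE x in leb_I. f x = prim g x - m"
    by eventually_elim (use f ih mean in \<open>simp add: m_def L2_I_integrable\<close>)
  have bound: "\<bar>prim g x - m\<bar> \<le> L2_norm g" for x
  proof -
    have "prim g x - m = (LINT y|leb_I. prim g x - prim g y)"
      using ih leb_I.prob_space by (simp add: m_def)
    also have "\<bar>\<dots>\<bar> \<le> (LINT y|leb_I. \<bar>prim g x - prim g y\<bar>)" by (rule integral_abs_bound)
    also have "\<dots> \<le> (LINT y|leb_I. (LINT z|leb_I. \<bar>g z\<bar>))"
      using ih by (intro integral_mono integrable_abs Bochner_Integration.integrable_diff prim_diff_le[OF ig]) auto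
    also have "\<dots> \<le> L2_norm g" using L1_le_L2_norm[OF g] leb_I.prob_space by simp
    finally show ?thesis .
  qed
  have "(LINT x|leb_I. (f x)\<^sup>2) \<le> (LINT x|leb_I. (L2_norm g)\<^sup>2)"
  proof (rule integral_mono_AE)
    show "AE x in leb_I. (f x)\<^sup>2 \<le> (L2_norm g)\<^sup>2"
      using repr by eventually_elim (use bound in \<open>simp add: abs_le_square_iff[symmetric]\<close>)
  qed (use f L2_I_square in auto)
  then show ?thesis using leb_I.prob_space by (simp add: L2_norm_le_iff)
qed

section \<open>Existence of the optimal decomposition\<close>

lemma AE_leb_I_dense:
  assumes "AE x in leb_I. x \<in> A" "0 \<le> a" "a < b" "b \<le> 1"
  obtains y where "y \<in> A" "a < y" "y < b"
proof (rule ccontr)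
  assume "\<not> thesis"
  then have "AE x in leb_I. x \<notin> {a<..<b}"
    using assms(1) that by auto
  then have "{a<..<b} \<in> null_sets leb_I"
    using assms by (subst AE_iff_null_sets) (auto simp: sets_restrict_space subset_eq)
  moreover have "emeasure leb_I {a<..<b} = ennreal (b - a)"
    using assms by (subst emeasure_restrict_space) (auto simp: subset_eq)
  ultimately show False using assms by (auto simp: null_sets_def)
qed

text \<open>Monotonicity on a set of full measure needs no second function, so sums, maxima and
  limits are handled by intersecting sets. A function monotone on such a set extends to all of
  \<open>I\<close> as a supremum from the left.\<close>

lemma ae_nondecreasing_iff:
  "ae_nondecreasing f \<longleftrightarrow> (\<exists>A. (AE x in leb_I. x \<in> A) \<and> mono_on A f)"
proof
  assume "ae_nondecreasing f"
  then obtain g where g: "mono_on I g" "AE x in leb_I. f x = g x"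
    by (auto simp: ae_nondecreasing_def)
  have "AE x in leb_I. x \<in> {x \<in> I. f x = g x}"
    using g(2) AE_space[of leb_I] by eventually_elim simp
  moreover have "mono_on {x \<in> I. f x = g x} f"
    using g(1) by (auto simp: mono_on_def)
  ultimately show "\<exists>A. (AE x in leb_I. x \<in> A) \<and> mono_on A f" by blast
next
  assume "\<exists>A. (AE x in leb_I. x \<in> A) \<and> mono_on A f"
  then obtain A where A: "AE x in leb_I. x \<in> A" "mono_on A f" by blast
  \<comment> \<open>A set of full measure has points on both sides of every \<open>x\<close> in
    \<open>I\<close>: those on the left make the supremum range over a nonempty set, one on the
    right bounds it.\<close>
  define g where "g x = Sup (f ` {y \<in> A. y \<le> x})" for x
  have ne: "{y \<in> A. y \<le> x} \<noteq> {}" if "x \<in> I" for x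
    by (rule AE_leb_I_dense[OF A(1), of 0 x]) (use that in auto)
  have bdd: "bdd_above (f ` {y \<in> A. y \<le> x})" if x: "x \<in> I" for x
  proof -
    obtain z where "z \<in> A" "x < z" by (rule AE_leb_I_dense[OF A(1), of x 1]) (use x in auto)
    then show ?thesis using A(2) by (intro bdd_aboveI2[of _ _ "f z"]) (auto simp: mono_on_def)
  qed
  have "mono_on I g"
    unfolding g_def by (intro mono_onI cSup_subset_mono bdd) (use ne in auto)
  moreover have "AE x in leb_I. f x = g x"
    using A(1)
  proof eventually_elim
    fix x assume "x \<in> A"
    then show "f x = g x" unfolding g_def using A(2)
      by (intro cSup_eq_maximum[symmetric]) (auto simp: mono_on_def)
  qed
  ultimately show "ae_nondecreasing f" by (auto simp: ae_nondecreasing_def)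
qed

lemma ae_nonincreasing_iff: "ae_nonincreasing f \<longleftrightarrow> ae_nondecreasing (\<lambda>x. - f x)"
proof
  assume "ae_nonincreasing f"
  then obtain g where "antimono_on I g" "AE x in leb_I. f x = g x"
    by (auto simp: ae_nonincreasing_def)
  then have "mono_on I (\<lambda>x. - g x)" "AE x in leb_I. - f x = - g x"
    by (auto simp: monotone_on_def)
  then show "ae_nondecreasing (\<lambda>x. - f x)" unfolding ae_nondecreasing_def by blast
next
  assume "ae_nondecreasing (\<lambda>x. - f x)"
  then obtain g where g: "mono_on I g" "AE x in leb_I. - f x = g x"
    by (auto simp: ae_nondecreasing_def)
  have "antimono_on I (\<lambda>x. - g x)" using g(1) by (auto simp: monotone_on_def)
  moreover have "AE x in leb_I. f x = - g x" using g(2) by eventually_elim simp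
  ultimately show "ae_nonincreasing f" unfolding ae_nonincreasing_def by blast
qed

lemma ae_nondecreasing_const [simp]: "ae_nondecreasing (\<lambda>x. c)"
  unfolding ae_nondecreasing_iff by (intro exI[of _ UNIV]) (auto simp: mono_on_def)

lemma ae_nondecreasing_linear:
  assumes "ae_nondecreasing f" "ae_nondecreasing g" "0 \<le> a" "0 \<le> b"
  shows "ae_nondecreasing (\<lambda>x. a * f x + b * g x)"
proof -
  obtain A B where "AE x in leb_I. x \<in> A" "mono_on A f" "AE x in leb_I. x \<in> B" "mono_on B g"
    using assms by (auto simp: ae_nondecreasing_iff)
  then show ?thesis using assms(3,4) unfolding ae_nondecreasing_iff
    by (intro exI[of _ "A \<inter> B"]) (auto simp: mono_on_def intro!: add_mono mult_left_mono)
qed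

lemma ae_nondecreasing_max:
  assumes "ae_nondecreasing f" "ae_nondecreasing g"
  shows "ae_nondecreasing (\<lambda>x. max (f x) (g x))"
proof -
  obtain A B where "AE x in leb_I. x \<in> A" "mono_on A f" "AE x in leb_I. x \<in> B" "mono_on B g"
    using assms by (auto simp: ae_nondecreasing_iff)
  then show ?thesis unfolding ae_nondecreasing_iff
    by (intro exI[of _ "A \<inter> B"]) (force simp: mono_on_def le_max_iff_disj)
qed

lemma ae_nondecreasing_cong_AE:
  assumes "ae_nondecreasing f" "AE x in leb_I. f x = g x"
  shows "ae_nondecreasing g"
proof -
  obtain h where "mono_on I h" "AE x in leb_I. f x = h x"
    using assms(1) by (auto simp: ae_nondecreasing_def)
  moreover from this(2) assms(2) have "AE x in leb_I. g x = h x" by eventually_elim simp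
  ultimately show ?thesis by (auto simp: ae_nondecreasing_def)
qed

lemma ae_nondecreasing_lim:
  assumes f: "\<And>n::nat. ae_nondecreasing (f n)" and lim: "AE x in leb_I. (\<lambda>n. f n x) \<longlonglongrightarrow> F x"
  shows "ae_nondecreasing F"
proof -
  have "\<forall>n. \<exists>A. (AE x in leb_I. x \<in> A) \<and> mono_on A (f n)"
    using f by (auto simp: ae_nondecreasing_iff)
  then obtain A where A: "\<And>n. AE x in leb_I. x \<in> A n" "\<And>n. mono_on (A n) (f n)" by metis
  define B where "B = {x \<in> (\<Inter>n. A n). (\<lambda>n. f n x) \<longlonglongrightarrow> F x}"
  have "AE x in leb_I. \<forall>n. x \<in> A n" using A(1) by (simp add: AE_all_countable)
  with lim have "AE x in leb_I. x \<in> B" by eventually_elim (simp add: B_def)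
  moreover have "mono_on B F"
  proof (rule mono_onI)
    fix x y assume "x \<in> B" "y \<in> B" "x \<le> y"
    then show "F x \<le> F y" using A(2)
      by (intro LIMSEQ_le[of "\<lambda>n. f n x" _ "\<lambda>n. f n y"]) (auto simp: B_def mono_on_def)
  qed
  ultimately show ?thesis unfolding ae_nondecreasing_iff by blast
qed

text \<open>Riesz-Fischer for a geometric rate: the increments are summable in L1, so the sequence
  converges a.e. without passing to a subsequence. The pointwise limit is what later carries
  monotonicity to the limit function.\<close>

lemma L2_complete:
  assumes f: "\<And>n. f n \<in> L2_I" and c: "\<And>n. L2_dist (f n) (f (Suc n)) \<le> c * (1/2) ^ n"
  obtains F where "F \<in> L2_I" "(\<lambda>n. L2_dist (f n) F) \<longlonglongrightarrow> 0" "AE x in leb_I. (\<lambda>n. f n x) \<longlonglongrightarrow> F x"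
proof -
  have [measurable]: "f n \<in> borel_measurable leb_I" for n using f by (rule L2_I_measurable)
  have "0 \<le> c" using order.trans[OF L2_dist_nonneg c[of 0]] by simp
  \<comment> \<open>The geometric sum in telescoped form; keeping the subtracted term is what lets
    the induction close.\<close>
  have dist: "L2_dist (f n) (f (n + j)) \<le> 2 * c * (1/2) ^ n - 2 * c * (1/2) ^ (n + j)" for n j
  proof (induction j)
    case (Suc j)
    have "L2_dist (f n) (f (n + Suc j)) \<le> L2_dist (f n) (f (n + j)) + L2_dist (f (n + j)) (f (Suc (n + j)))"
      using L2_dist_triangle[OF f f f] by simp
    also have "\<dots> \<le> (2 * c * (1/2) ^ n - 2 * c * (1/2) ^ (n + j)) + c * (1/2) ^ (n + j)"
      by (intro add_mono Suc c)
    finally show ?case by simp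
  qed (simp add: L2_dist_def L2_norm_def)
  have dist': "L2_dist (f n) (f k) \<le> 2 * c * (1/2) ^ n" if "n \<le> k" for n k
    using dist[of n "k - n"] that \<open>0 \<le> c\<close> by (simp add: order.trans)
  have "(\<integral>\<^sup>+x. (\<Sum>n. ennreal \<bar>f (Suc n) x - f n x\<bar>) \<partial>leb_I) = (\<Sum>n. \<integral>\<^sup>+x. ennreal \<bar>f (Suc n) x - f n x\<bar> \<partial>leb_I)"
    by (intro nn_integral_suminf) measurable
  also have "\<dots> \<le> (\<Sum>n. ennreal (c * (1/2) ^ n))"
  proof (intro suminf_le allI summableI)
    fix n
    have d: "(\<lambda>x. f (Suc n) x - f n x) \<in> L2_I" using f by (intro L2_I_diff)
    have "(\<integral>\<^sup>+x. ennreal \<bar>f (Suc n) x - f n x\<bar> \<partial>leb_I) = ennreal (LINT x|leb_I. \<bar>f (Suc n) x - f n x\<bar>)"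
      using d by (intro nn_integral_eq_integral integrable_abs L2_I_integrable) auto
    also have "\<dots> \<le> ennreal (c * (1/2) ^ n)"
      using L1_le_L2_norm[OF d] c[of n] by (intro ennreal_leI) (simp add: L2_dist_def L2_norm_minus_commute)
    finally show "(\<integral>\<^sup>+x. ennreal \<bar>f (Suc n) x - f n x\<bar> \<partial>leb_I) \<le> ennreal (c * (1/2) ^ n)" .
  qed
  also have "\<dots> < \<infinity>"
  proof -
    have "summable (\<lambda>n. c * (1/2) ^ n)" by (intro summable_mult summable_geometric) simp
    then show ?thesis using \<open>0 \<le> c\<close> by (subst suminf_ennreal2) auto
  qed
  finally have "AE x in leb_I. (\<Sum>n. ennreal \<bar>f (Suc n) x - f n x\<bar>) \<noteq> \<infinity>"
    by (intro nn_integral_PInf_AE) auto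
  then have conv: "AE x in leb_I. convergent (\<lambda>n. f n x)"
  proof eventually_elim
    fix x assume "(\<Sum>n. ennreal \<bar>f (Suc n) x - f n x\<bar>) \<noteq> \<infinity>"
    then have "summable (\<lambda>n. \<bar>f (Suc n) x - f n x\<bar>)"
      by (intro summable_suminf_not_top) auto
    then have "summable (\<lambda>n. f (Suc n) x - f n x)" by (rule summable_rabs_cancel)
    then have "convergent (\<lambda>n. f n x - f 0 x)"
      by (simp add: summable_iff_convergent sum_lessThan_telescope[of "\<lambda>n. f n x"])
    then show "convergent (\<lambda>n. f n x)"
      using convergent_diff_const_right_iff by blast
  qed
  define F where "F x = lim (\<lambda>n. f n x)" for x
  have [measurable]: "F \<in> borel_measurable leb_I"
    unfolding F_def[abs_def] by measurable
  have lim: "AE x in leb_I. (\<lambda>n. f n x) \<longlonglongrightarrow> F x"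
    using conv by eventually_elim (simp add: F_def convergent_LIMSEQ_iff)
  \<comment> \<open>Fatou's lemma as \<open>k\<close> tends to infinity turns the Cauchy bound
    between \<open>f n\<close> and \<open>f k\<close> into one between \<open>f n\<close> and
    \<open>F\<close>.\<close>
  have fatou: "(\<integral>\<^sup>+x. ennreal ((f n x - F x)\<^sup>2) \<partial>leb_I) \<le> ennreal ((2 * c * (1/2) ^ n)\<^sup>2)" for n
  proof -
    have "(\<integral>\<^sup>+x. ennreal ((f n x - F x)\<^sup>2) \<partial>leb_I) = (\<integral>\<^sup>+x. liminf (\<lambda>k. ennreal ((f n x - f k x)\<^sup>2)) \<partial>leb_I)"
    proof (rule nn_integral_cong_AE, use lim in eventually_elim)
      fix x assume "(\<lambda>k. f k x) \<longlonglongrightarrow> F x"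
      then have "(\<lambda>k. ennreal ((f n x - f k x)\<^sup>2)) \<longlonglongrightarrow> ennreal ((f n x - F x)\<^sup>2)"
        by (intro tendsto_ennrealI tendsto_intros)
      then show "ennreal ((f n x - F x)\<^sup>2) = liminf (\<lambda>k. ennreal ((f n x - f k x)\<^sup>2))"
        by (intro lim_imp_Liminf[symmetric]) auto
    qed
    also have "\<dots> \<le> liminf (\<lambda>k. \<integral>\<^sup>+x. ennreal ((f n x - f k x)\<^sup>2) \<partial>leb_I)"
      by (intro nn_integral_liminf) measurable
    also have "\<dots> \<le> ennreal ((2 * c * (1/2) ^ n)\<^sup>2)"
    proof (rule Liminf_le)
      show "\<forall>\<^sub>F k in sequentially. (\<integral>\<^sup>+x. ennreal ((f n x - f k x)\<^sup>2) \<partial>leb_I) \<le> ennreal ((2 * c * (1/2) ^ n)\<^sup>2)"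
        using eventually_ge_at_top[of n]
      proof eventually_elim
        fix k assume "n \<le> k"
        have "(\<integral>\<^sup>+x. ennreal ((f n x - f k x)\<^sup>2) \<partial>leb_I) = ennreal (LINT x|leb_I. (f n x - f k x)\<^sup>2)"
          using f by (intro nn_integral_eq_integral L2_I_square L2_I_diff) auto
        also have "(LINT x|leb_I. (f n x - f k x)\<^sup>2) \<le> (2 * c * (1/2) ^ n)\<^sup>2"
          using dist'[OF \<open>n \<le> k\<close>] \<open>0 \<le> c\<close> by (simp add: L2_dist_def L2_norm_le_iff)
        finally show "(\<integral>\<^sup>+x. ennreal ((f n x - f k x)\<^sup>2) \<partial>leb_I) \<le> ennreal ((2 * c * (1/2) ^ n)\<^sup>2)"
          by (simp add: ennreal_leI)
      qed
    qed simp
    finally show ?thesis .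
  qed
  have diff: "(\<lambda>x. f n x - F x) \<in> L2_I" for n
  proof -
    have "integrable leb_I (\<lambda>x. (f n x - F x)\<^sup>2)"
      using le_less_trans[OF fatou[of n]] by (intro integrableI_bounded) auto
    then show ?thesis by (simp add: L2_I_def)
  qed
  have bound: "L2_dist (f n) F \<le> 2 * c * (1/2) ^ n" for n
  proof -
    have "ennreal (LINT x|leb_I. (f n x - F x)\<^sup>2) = (\<integral>\<^sup>+x. ennreal ((f n x - F x)\<^sup>2) \<partial>leb_I)"
      using L2_I_square[OF diff] by (intro nn_integral_eq_integral[symmetric]) auto
    then have "ennreal (LINT x|leb_I. (f n x - F x)\<^sup>2) \<le> ennreal ((2 * c * (1/2) ^ n)\<^sup>2)"
      using fatou[of n] by (simp only:)
    then have "(LINT x|leb_I. (f n x - F x)\<^sup>2) \<le> (2 * c * (1/2) ^ n)\<^sup>2"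
      by (subst (asm) ennreal_le_iff) auto
    then show ?thesis using \<open>0 \<le> c\<close> by (simp add: L2_dist_def L2_norm_le_iff)
  qed
  have "(\<lambda>n. L2_dist (f n) F) \<longlonglongrightarrow> 0"
  proof (rule tendsto_sandwich[OF _ _ tendsto_const])
    show "(\<lambda>n. 2 * c * (1/2) ^ n) \<longlonglongrightarrow> 0" by real_asymp
  qed (use bound in \<open>auto intro!: always_eventually\<close>)
  moreover have "F \<in> L2_I" using L2_I_diff[OF f diff, of 0 0] by simp
  ultimately show ?thesis using that lim by blast
qed

section \<open>Decompositions and the minimizer of the Dirichlet energy\<close>

lemma decompsD:
  assumes "(w1, w2) \<in> decomps w"
  shows "w1 \<in> L2_I" "is_weak_deriv w2 (weak_deriv w2)" "w2 \<in> L2_I" "ae_nondecreasing w1"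
    "ae_nondecreasing (\<lambda>x. - w2 x)" "(LINT x|leb_I. w2 x) = 0" "AE x in leb_I. w x = w1 x + w2 x"
  using assms weak_deriv_is_weak_deriv[of w2] is_weak_deriv_L2_I[of w2 "weak_deriv w2"]
  by (auto simp: decomps_def ae_nonincreasing_iff)

lemma decompsI:
  assumes "w1 \<in> L2_I" "is_weak_deriv w2 g" "ae_nondecreasing w1"
    "ae_nondecreasing (\<lambda>x. - w2 x)" "(LINT x|leb_I. w2 x) = 0" "AE x in leb_I. w x = w1 x + w2 x"
  shows "(w1, w2) \<in> decomps w"
  using assms by (auto simp: decomps_def ae_nonincreasing_iff H1_I_def)

text \<open>Convexity of the set of decompositions in the one case that the parallelogram identity
  asks for: the midpoint of two competitors is a competitor.\<close>

lemma decomps_midpoint: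
  assumes "(a1, a2) \<in> decomps w" "(b1, b2) \<in> decomps w"
  shows "((\<lambda>x. 1/2 * a1 x + 1/2 * b1 x), (\<lambda>x. 1/2 * a2 x + 1/2 * b2 x)) \<in> decomps w"
proof (rule decompsI)
  note a = decompsD[OF assms(1)] and b = decompsD[OF assms(2)]
  show "is_weak_deriv (\<lambda>x. 1/2 * a2 x + 1/2 * b2 x) (\<lambda>x. 1/2 * weak_deriv a2 x + 1/2 * weak_deriv b2 x)"
    using a b by (intro is_weak_deriv_linear)
  show "ae_nondecreasing (\<lambda>x. 1/2 * a1 x + 1/2 * b1 x)"
    using a b by (intro ae_nondecreasing_linear) auto
  have "ae_nondecreasing (\<lambda>x. 1/2 * (- a2 x) + 1/2 * (- b2 x))"
    using a b by (intro ae_nondecreasing_linear) auto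
  then show "ae_nondecreasing (\<lambda>x. - (1/2 * a2 x + 1/2 * b2 x))" by (simp add: algebra_simps)
  show "(LINT x|leb_I. 1/2 * a2 x + 1/2 * b2 x) = 0"
    using a b by (simp add: L2_I_integrable)
  show "AE x in leb_I. w x = 1/2 * a1 x + 1/2 * b1 x + (1/2 * a2 x + 1/2 * b2 x)"
    using a(7) b(7) by eventually_elim simp
  show "(\<lambda>x. 1/2 * a1 x + 1/2 * b1 x) \<in> L2_I"
    using a(1) b(1) by (intro L2_I_add L2_I_cmult)
qed

text \<open>A minimizing sequence has a Cauchy sequence of derivatives, by the parallelogram identity.\<close>

lemma dirichlet_minimizer_exists:
  assumes w: "w \<in> decomposable"
  obtains p where "p \<in> decomps w" "\<And>q. q \<in> decomps w \<Longrightarrow> dirichlet (snd p) \<le> dirichlet (snd q)"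
proof -
  define D where "D = (\<lambda>q. dirichlet (snd q)) ` decomps w"
  define m where "m = Inf D"
  have wL2: "w \<in> L2_I" and ne: "D \<noteq> {}" using w by (auto simp: decomposable_def D_def)
  have bdd: "bdd_below D" by (intro bdd_belowI[of _ 0]) (auto simp: D_def)
  have m_le: "m \<le> dirichlet w2" if "(w1, w2) \<in> decomps w" for w1 w2
    unfolding m_def using that bdd by (intro cInf_lower) (force simp: D_def)
  \<comment> \<open>The tolerance \<open>(1/4) ^ n\<close> is the square of the rate
    \<open>(1/2) ^ n\<close> that \<open>L2_complete\<close> expects, as energies control squared
    distances.\<close>
  have "\<exists>w1 w2. (w1, w2) \<in> decomps w \<and> dirichlet w2 < m + (1/4) ^ n" for n :: nat
  proof -
    have "Inf D < m + (1/4) ^ n" by (simp add: m_def)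
    then show ?thesis using cInf_lessD[OF ne] by (force simp: D_def)
  qed
  then obtain w1 f where wf: "\<And>n. (w1 n, f n) \<in> decomps w" and Df: "\<And>n::nat. dirichlet (f n) < m + (1/4) ^ n"
    by metis
  define g where "g n = weak_deriv (f n)" for n
  note d = decompsD[OF wf]
  have fg: "is_weak_deriv (f n) (g n)" for n using d(2) by (simp add: g_def)
  have f: "f n \<in> L2_I" and g: "g n \<in> L2_I" for n using is_weak_deriv_L2_I[OF fg] by auto
  have g_norm: "(L2_norm (g n))\<^sup>2 \<le> 2 * (m + (1/4) ^ n)" for n
    using Df[of n] dirichlet_eq[OF fg, of n] by simp
  have g_dist: "L2_dist (g n) (g (Suc n)) \<le> 3 * (1/2) ^ n" for n
  proof -
    have "m \<le> dirichlet (\<lambda>x. 1/2 * f n x + 1/2 * f (Suc n) x)"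
      by (rule m_le[OF decomps_midpoint[OF wf wf]])
    also have "\<dots> = 1/2 * (L2_norm (\<lambda>x. 1/2 * g n x + 1/2 * g (Suc n) x))\<^sup>2"
      by (rule dirichlet_eq[OF is_weak_deriv_linear[OF fg fg]])
    also have "L2_norm (\<lambda>x. 1/2 * g n x + 1/2 * g (Suc n) x) = 1/2 * L2_norm (\<lambda>x. g n x + g (Suc n) x)"
      using L2_norm_cmult[of "1/2" "\<lambda>x. g n x + g (Suc n) x"] by (simp add: distrib_left)
    finally have "8 * m \<le> (L2_norm (\<lambda>x. g n x + g (Suc n) x))\<^sup>2" by (simp add: power_mult_distrib power_divide)
    moreover have "(L2_norm (\<lambda>x. g n x + (- g (Suc n) x)))\<^sup>2 + (L2_norm (\<lambda>x. g n x + g (Suc n) x))\<^sup>2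
        = 2 * (L2_norm (g n))\<^sup>2 + 2 * (L2_norm (g (Suc n)))\<^sup>2"
      using L2_norm_cmult[of "-1" "g (Suc n)"]
      by (subst (1 2) L2_norm_add_power2) (auto simp: g L2_I_uminus L2_inner_minus_right)
    \<comment> \<open>The terms in \<open>m\<close> cancel and \<open>5 * (1/4) ^ n\<close> remains;
      5 is then rounded up to the square 9.\<close>
    ultimately have "(L2_norm (\<lambda>x. g n x - g (Suc n) x))\<^sup>2 \<le> 4 * (m + (1/4) ^ n) + 4 * (m + (1/4) ^ Suc n) - 8 * m"
      using g_norm[of n] g_norm[of "Suc n"] by simp
    also have "\<dots> = 5 * (1/4) ^ n" by simp
    also have "\<dots> \<le> 9 * (1/4) ^ n" by (intro mult_right_mono) auto
    also have "\<dots> = (3 * (1/2) ^ n)\<^sup>2"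
      by (simp add: power2_eq_square flip: power_mult_distrib)
    finally show ?thesis unfolding L2_dist_def by (rule power2_le_imp_le) simp
  qed
  \<comment> \<open>Poincare applied to a difference of two parts of mean zero: convergence of the
    derivatives forces convergence of the functions.\<close>
  have f_dist: "L2_dist (f n) (f (Suc n)) \<le> 3 * (1/2) ^ n" for n
  proof -
    have "L2_norm (\<lambda>x. 1 * f n x + (- 1) * f (Suc n) x) \<le> L2_norm (\<lambda>x. 1 * g n x + (- 1) * g (Suc n) x)"
      using d(6) f by (intro Poincare_inequality is_weak_deriv_linear fg) (simp add: L2_I_integrable)
    then show ?thesis using g_dist[of n] by (simp add: L2_dist_def)
  qed
  obtain G where G: "G \<in> L2_I" "(\<lambda>n. L2_dist (g n) G) \<longlonglongrightarrow> 0"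
    using L2_complete[OF g g_dist] by blast
  obtain F where F: "F \<in> L2_I" "(\<lambda>n. L2_dist (f n) F) \<longlonglongrightarrow> 0" "AE x in leb_I. (\<lambda>n. f n x) \<longlonglongrightarrow> F x"
    using L2_complete[OF f f_dist] by blast
  have FG: "is_weak_deriv F G"
  proof (rule is_weak_derivI[OF F(1) G(1)])
    fix \<phi> assume \<phi>: "\<phi> \<in> test_functions"
    have "(\<lambda>n. L2_inner (f n) (deriv \<phi>)) \<longlonglongrightarrow> L2_inner F (deriv \<phi>)"
      by (rule L2_inner_tendsto[OF F(2) f F(1) deriv_test_function_L2_I[OF \<phi>]])
    moreover have "(\<lambda>n. - L2_inner (g n) \<phi>) \<longlonglongrightarrow> - L2_inner G \<phi>"
      by (intro tendsto_minus L2_inner_tendsto[OF G(2) g G(1) test_function_L2_I[OF \<phi>]])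
    ultimately show "L2_inner F (deriv \<phi>) = - L2_inner G \<phi>"
      using is_weak_derivD[OF fg \<phi>] LIMSEQ_unique by simp
  qed
  have mean: "(LINT x|leb_I. F x) = 0"
  proof -
    have "(\<lambda>n. L2_inner (f n) (\<lambda>x. 1)) \<longlonglongrightarrow> L2_inner F (\<lambda>x. 1)"
      by (rule L2_inner_tendsto[OF F(2) f F(1)]) simp
    then show ?thesis using d(6) LIMSEQ_unique[OF _ tendsto_const] by (simp add: L2_inner_def)
  qed
  \<comment> \<open>The first component is recovered as \<open>w\<close> minus the second, so only
    the second components have to converge.\<close>
  have "(\<lambda>x. w x - F x, F) \<in> decomps w"
  proof (rule decompsI[OF _ FG])
    show "(\<lambda>x. w x - F x) \<in> L2_I" using wL2 F(1) by (rule L2_I_diff)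
    show "ae_nondecreasing (\<lambda>x. - F x)"
      using d(5) by (rule ae_nondecreasing_lim) (use F(3) in \<open>eventually_elim, intro tendsto_minus\<close>)
    have "ae_nondecreasing (\<lambda>x. w x - f n x)" for n
      using d(4)[of n] by (rule ae_nondecreasing_cong_AE) (use d(7)[of n] in \<open>eventually_elim, simp\<close>)
    then show "ae_nondecreasing (\<lambda>x. w x - F x)"
      by (rule ae_nondecreasing_lim) (use F(3) in \<open>eventually_elim, intro tendsto_intros\<close>)
  qed (use mean in auto)
  moreover have "dirichlet F \<le> m"
  proof -
    have "L2_norm G \<le> sqrt (2 * (m + (1/4) ^ n)) + L2_dist (g n) G" for n
    proof -
      have "L2_norm G \<le> L2_norm (g n) + L2_dist (g n) G"
        using L2_norm_triangle[of "g n" "\<lambda>x. G x - g n x"] g G(1)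
        by (simp add: L2_dist_def L2_I_diff L2_norm_minus_commute[of G])
      also have "L2_norm (g n) \<le> sqrt (2 * (m + (1/4) ^ n))"
        using g_norm[of n] by (rule real_le_rsqrt)
      finally show ?thesis by simp
    qed
    moreover have "(\<lambda>n. sqrt (2 * (m + (1/4) ^ n)) + L2_dist (g n) G) \<longlonglongrightarrow> sqrt (2 * (m + 0)) + 0"
      by (intro tendsto_add G(2) tendsto_real_sqrt tendsto_mult tendsto_const LIMSEQ_power_zero) simp
    ultimately have "L2_norm G \<le> sqrt (2 * m)"
      by (intro LIMSEQ_le_const) auto
    moreover have "0 \<le> m" unfolding m_def using ne by (intro cInf_greatest) (auto simp: D_def)
    ultimately have "(L2_norm G)\<^sup>2 \<le> 2 * m"
      by (metis L2_norm_nonneg mult_nonneg_nonneg power_mono real_sqrt_pow2 zero_le_numeral)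
    then show ?thesis using dirichlet_eq[OF FG] by simp
  qed
  then have "dirichlet F \<le> dirichlet (snd q)" if "q \<in> decomps w" for q
    using m_le[of "fst q" "snd q"] that by simp
  ultimately show ?thesis
    using that[of "(\<lambda>x. w x - F x, F)"] by simp
qed

text \<open>\<open>ARG_MIN\<close> meets its specification because the minimum is attained. From
  here on the energy is compared with that of any decomposition that can be exhibited.\<close>

lemma opt_decomp_minimal:
  assumes "w \<in> decomposable"
  shows "opt_decomp w \<in> decomps w"
    and "q \<in> decomps w \<Longrightarrow> dirichlet (down_part w) \<le> dirichlet (snd q)"
proof -
  obtain p where p: "p \<in> decomps w" "\<And>q. q \<in> decomps w \<Longrightarrow> dirichlet (snd p) \<le> dirichlet (snd q)"
    using dirichlet_minimizer_exists[OF assms] by blast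
  have "opt_decomp w \<in> decomps w \<and> (\<forall>q\<in>decomps w. dirichlet (snd (opt_decomp w)) \<le> dirichlet (snd q))"
    unfolding opt_decomp_def by (rule arg_minI[of _ p]) (use p in \<open>auto simp: not_less\<close>)
  then show "opt_decomp w \<in> decomps w"
    and "q \<in> decomps w \<Longrightarrow> dirichlet (down_part w) \<le> dirichlet (snd q)"
    by (auto simp: down_part_def)
qed

section \<open>Comparison of directed energies\<close>

lemma directed_energy_nonneg: "0 \<le> directed_energy w"
  by (simp add: directed_energy_def)

lemma directed_energy_le:
  assumes "w \<in> L2_I" "(w1, w2) \<in> decomps w"
  shows "directed_energy w \<le> ereal (dirichlet w2)"
proof -
  have "w \<in> decomposable" using assms by (auto simp: decomposable_def)
  then show ?thesis using opt_decomp_minimal(2)[OF _ assms(2)] by (simp add: directed_energy_def)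
qed

lemma directed_energy_nondecreasing:
  assumes "z \<in> L2_I" "ae_nondecreasing z"
  shows "directed_energy z = 0"
proof -
  have 0: "is_weak_deriv (\<lambda>x. 0) (\<lambda>x. 0)" by (intro is_weak_derivI) (auto simp: L2_inner_def)
  have "(z, \<lambda>x. 0) \<in> decomps z" using assms by (intro decompsI[OF _ 0]) auto
  from directed_energy_le[OF assms(1) this] have "directed_energy z \<le> 0"
    using dirichlet_eq[OF 0] by (simp add: L2_norm_def zero_ereal_def)
  then show ?thesis using directed_energy_nonneg by (rule antisym)
qed

text \<open>With \<open>w = w1 + w2\<close>, the truncation is \<open>max w1 (- w2) + w2\<close>. As
  \<open>- w2\<close> is nondecreasing, so is the maximum, and the nonincreasing part
  \<open>w2\<close> with its energy is kept unchanged.\<close>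

lemma directed_energy_positive_part:
  assumes w: "w \<in> L2_I"
  shows "directed_energy (\<lambda>x. max (w x) 0) \<le> directed_energy w"
proof (cases "w \<in> decomposable")
  case True
  obtain w1 w2 where eq: "opt_decomp w = (w1, w2)" by fastforce
  with opt_decomp_minimal(1)[OF True] have "(w1, w2) \<in> decomps w" by simp
  note d = decompsD[OF this]
  have "(\<lambda>x. max (w1 x) (- w2 x), w2) \<in> decomps (\<lambda>x. max (w x) 0)"
  proof (rule decompsI[OF _ d(2)])
    show "(\<lambda>x. max (w1 x) (- w2 x)) \<in> L2_I" using d by (intro L2_I_max L2_I_uminus)
    show "ae_nondecreasing (\<lambda>x. max (w1 x) (- w2 x))" using d by (intro ae_nondecreasing_max)
    show "AE x in leb_I. max (w x) 0 = max (w1 x) (- w2 x) + w2 x"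
      using d(7) by eventually_elim (simp add: max_def)
  qed (use d in auto)
  from directed_energy_le[OF _ this] show ?thesis
    using w True eq by (simp add: directed_energy_def[of w] down_part_def L2_I_max)
qed (simp add: directed_energy_def)

section \<open>Functionals decreasing along the gradient flow\<close>

text \<open>
  Off a null set \<open>N\<close> the derivative bounds the increments; near \<open>N\<close> they are bounded by the integral
  of \<open>m\<close> over an open set around \<open>N\<close> that carries little of \<open>m\<close>. Bisection glues these local bounds.
\<close>

lemma nonincreasing_if_AE_derivative_nonpos:
  fixes q :: "real \<Rightarrow> real"
  assumes ab: "a \<le> b" and m: "set_integrable lborel {a..b} m"
    and ac: "\<And>s t. a \<le> s \<Longrightarrow> s \<le> t \<Longrightarrow> t \<le> b \<Longrightarrow> q t - q s \<le> (LINT r:{s..t}|lborel. m r)"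
    and deriv: "AE t in lborel. a \<le> t \<and> t \<le> b \<longrightarrow>
      (\<forall>e>0. \<exists>d>0. \<forall>h. 0 < h \<and> h < d \<longrightarrow>
        (t + h \<le> b \<longrightarrow> q (t + h) \<le> q t + e * h) \<and> (a \<le> t - h \<longrightarrow> q t \<le> q (t - h) + e * h))"
  shows "q b \<le> q a"
proof -
  obtain N where N: "N \<in> null_sets lborel"
    and off_N: "\<And>t e. t \<notin> N \<Longrightarrow> a \<le> t \<Longrightarrow> t \<le> b \<Longrightarrow> 0 < e \<Longrightarrow> \<exists>d>0. \<forall>h. 0 < h \<and> h < d \<longrightarrow>
        (t + h \<le> b \<longrightarrow> q (t + h) \<le> q t + e * h) \<and> (a \<le> t - h \<longrightarrow> q t \<le> q (t - h) + e * h)"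
    by (rule AE_E3[OF deriv]) simp
  define f where "f r = \<bar>m r\<bar> * indicator {a..b} r" for r
  have f: "integrable lborel f"
    using integrable_abs[OF m[unfolded set_integrable_def]]
    by (simp add: f_def[abs_def] abs_mult mult.commute)
  then have [measurable]: "f \<in> borel_measurable borel" by auto
  have f_nonneg: "0 \<le> f r" for r by (simp add: f_def)
  define \<mu> where "\<mu> = density lborel (\<lambda>r. ennreal (f r))"
  have \<mu>: "emeasure \<mu> A = ennreal (LINT r|lborel. f r * indicator A r)" if [measurable]: "A \<in> sets borel" for A
  proof -
    have "emeasure \<mu> A = (\<integral>\<^sup>+r. ennreal (f r * indicator A r) \<partial>lborel)"
      unfolding \<mu>_def by (subst emeasure_density) (auto intro!: nn_integral_cong split: split_indicator)
    also have "\<dots> = ennreal (LINT r|lborel. f r * indicator A r)"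
      using f that f_nonneg by (intro nn_integral_eq_integral integrable_real_mult_indicator) auto
    finally show ?thesis .
  qed
  \<comment> \<open>The term \<open>e * (b - a)\<close> collects the increments controlled by the
    derivative; the additional \<open>e\<close> pays for an open neighbourhood of
    \<open>N\<close>.\<close>
  have small: "q b - q a \<le> e * (b - a) + e" if e: "0 < e" for e
  proof -
    have NB: "N \<in> sets borel" using N by (auto simp: null_sets_def)
    have "emeasure \<mu> N = 0"
    proof -
      have "AE r in lborel. r \<notin> N" using N by (rule AE_not_in)
      then have "AE r in lborel. f r * indicator N r = 0" by eventually_elim simp
      then have "(LINT r|lborel. f r * indicator N r) = 0" by (rule integral_eq_zero_AE)
      then show ?thesis using \<mu>[OF NB] by simp
    qed
    \<comment> \<open>Outer regularity of the finite measure \<open>\<mu>\<close>, for which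
      \<open>N\<close> is null.\<close>
    then have "(INF U\<in>{U. N \<subseteq> U \<and> open U}. emeasure \<mu> U) < ennreal e"
      using outer_regular[of \<mu> N] NB \<mu>[of UNIV] e by (simp add: \<mu>_def)
    then obtain U where U: "N \<subseteq> U" "open U" "emeasure \<mu> U < ennreal e"
      unfolding INF_less_iff by blast
    have UB [measurable]: "U \<in> sets borel" using U(2) by simp
    \<comment> \<open>The mass of \<open>\<bar>m\<bar>\<close> in \<open>U\<close> up to time
      \<open>t\<close>. Its increments add up over adjacent intervals, as gluing requires, and their
      total is at most \<open>e\<close>.\<close>
    define J where "J t = (LINT r|lborel. f r * indicator (U \<inter> {..t}) r)" for t
    have fi: "integrable lborel (\<lambda>r. f r * indicator A r)" if "A \<in> sets borel" for A
      using f that by (intro integrable_real_mult_indicator) auto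
    have J_diff: "J t - J s = (LINT r|lborel. f r * indicator (U \<inter> {s<..t}) r)" if "s \<le> t" for s t
    proof -
      have "J t - J s = (LINT r|lborel. f r * indicator (U \<inter> {..t}) r - f r * indicator (U \<inter> {..s}) r)"
        unfolding J_def using UB by (intro Bochner_Integration.integral_diff[symmetric] fi) auto
      also have "\<dots> = (LINT r|lborel. f r * indicator (U \<inter> {s<..t}) r)"
        using that by (intro Bochner_Integration.integral_cong) (auto split: split_indicator)
      finally show ?thesis .
    qed
    have J_mono: "J s \<le> J t" if "s \<le> t" for s t
    proof -
      have "0 \<le> (LINT r|lborel. f r * indicator (U \<inter> {s<..t}) r)"
        by (intro Bochner_Integration.integral_nonneg) (simp add: f_nonneg)
      then show ?thesis using J_diff[OF that] by simp
    qed
    have "a \<le> a \<longrightarrow> a \<le> b \<longrightarrow> b \<le> b \<longrightarrow> q b - q a \<le> e * (b - a) + (J b - J a)"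
    proof (rule Bolzano[OF ab, where P = "\<lambda>s t. a \<le> s \<longrightarrow> s \<le> t \<longrightarrow> t \<le> b \<longrightarrow> q t - q s \<le> e * (t - s) + (J t - J s)"])
      fix x y z
      assume *: "a \<le> x \<longrightarrow> x \<le> y \<longrightarrow> y \<le> b \<longrightarrow> q y - q x \<le> e * (y - x) + (J y - J x)"
        "a \<le> y \<longrightarrow> y \<le> z \<longrightarrow> z \<le> b \<longrightarrow> q z - q y \<le> e * (z - y) + (J z - J y)" "x \<le> y" "y \<le> z"
      have "e * (z - x) = e * (z - y) + e * (y - x)" by (simp add: algebra_simps)
      with * show "a \<le> x \<longrightarrow> x \<le> z \<longrightarrow> z \<le> b \<longrightarrow> q z - q x \<le> e * (z - x) + (J z - J x)"
        by auto
    next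
      fix x assume x: "a \<le> x" "x \<le> b"
      show "\<exists>d>0. \<forall>s t. s \<le> x \<and> x \<le> t \<and> t - s < d \<longrightarrow>
        (a \<le> s \<longrightarrow> s \<le> t \<longrightarrow> t \<le> b \<longrightarrow> q t - q s \<le> e * (t - s) + (J t - J s))"
      proof (cases "x \<in> U")
        case True
        then obtain d where d: "0 < d" "ball x d \<subseteq> U" using U(2) openE by blast
        have "q t - q s \<le> e * (t - s) + (J t - J s)"
          if st: "s \<le> x" "x \<le> t" "t - s < d" "a \<le> s" "t \<le> b" for s t
        proof -
          have sub: "{s..t} \<subseteq> U" using st d(2) by (auto simp: dist_real_def subset_eq)
          have le: "s \<le> t" using st by simp
          have "q t - q s \<le> (LINT r:{s..t}|lborel. m r)" using ac[OF st(4) le st(5)] .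
          also have "\<dots> \<le> (LINT r|lborel. f r * indicator {s..t} r)"
            unfolding set_lebesgue_integral_def
          proof (rule integral_mono)
            have "set_integrable lborel {s..t} m"
              by (rule set_integrable_subset[OF m]) (use st in auto)
            then show "integrable lborel (\<lambda>r. indicator {s..t} r *\<^sub>R m r)"
              by (simp add: set_integrable_def)
            show "integrable lborel (\<lambda>r. f r * indicator {s..t} r)" by (rule fi) simp
            show "indicator {s..t} r *\<^sub>R m r \<le> f r * indicator {s..t} r" for r
              using st by (auto simp: f_def split: split_indicator)
          qed
          also have "\<dots> = (LINT r|lborel. f r * indicator (U \<inter> {s<..t}) r)"
          proof (rule integral_cong_AE)
            show "AE r in lborel. f r * indicator {s..t} r = f r * indicator (U \<inter> {s<..t}) r"
              using AE_lborel_singleton[of s]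
              by eventually_elim (use sub in \<open>auto split: split_indicator\<close>)
          qed auto
          also have "\<dots> = J t - J s" using J_diff[OF le] by simp
          finally show ?thesis using e le by (simp add: add_increasing)
        qed
        then show ?thesis using d(1) by blast
      next
        case False
        then have "x \<notin> N" using U(1) by auto
        from off_N[OF this x e] obtain d where d: "0 < d"
          "\<And>h. 0 < h \<Longrightarrow> h < d \<Longrightarrow> x + h \<le> b \<Longrightarrow> q (x + h) \<le> q x + e * h"
          "\<And>h. 0 < h \<Longrightarrow> h < d \<Longrightarrow> a \<le> x - h \<Longrightarrow> q x \<le> q (x - h) + e * h"
          by blast
        have "q t - q s \<le> e * (t - s) + (J t - J s)"
          if st: "s \<le> x" "x \<le> t" "t - s < d" "a \<le> s" "t \<le> b" for s t
        proof -
          \<comment> \<open>The interval straddles \<open>x\<close>, so the forward bound serves its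
            right half and the backward bound its left half. An empty half is treated apart, because
            the bounds require a positive step.\<close>
          have "q t \<le> q x + e * (t - x)" using d(2)[of "t - x"] st by (cases "t = x") auto
          moreover have "q x \<le> q s + e * (x - s)" using d(3)[of "x - s"] st by (cases "s = x") auto
          moreover have "e * (t - s) = e * (t - x) + e * (x - s)" by (simp add: algebra_simps)
          moreover have "J s \<le> J t" using st by (intro J_mono) simp
          ultimately show ?thesis by linarith
        qed
        then show ?thesis using d(1) by blast
      qed
    qed
    then have "q b - q a \<le> e * (b - a) + (J b - J a)" using ab by simp
    moreover have "J b - J a \<le> e"
    proof -
      have "J b - J a \<le> (LINT r|lborel. f r * indicator U r)"
        unfolding J_diff[OF ab] using UB f_nonneg
        by (intro integral_mono fi) (auto split: split_indicator)
      moreover have "ennreal (LINT r|lborel. f r * indicator U r) < ennreal e"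
        using U(3) \<mu>[OF UB] by simp
      ultimately show ?thesis using e by (simp add: ennreal_less_iff f_nonneg)
    qed
    ultimately show ?thesis by simp
  qed
  have "q b \<le> q a + e" if "0 < e" for e
  proof -
    \<comment> \<open>Dividing by \<open>b - a + 1\<close> makes the two error terms add up to
      exactly \<open>e\<close>.\<close>
    have "q b - q a \<le> e / (b - a + 1) * (b - a) + e / (b - a + 1)"
      using that ab by (intro small) simp
    also have "\<dots> = e / (b - a + 1) * (b - a + 1)" by (simp only: distrib_left mult_1_right)
    also have "\<dots> = e" using ab by simp
    finally show ?thesis by simp
  qed
  then show ?thesis by (rule field_le_epsilon)
qed

text \<open>
  The models are the squared distance to a nondecreasing function and the squared distance to the
  cone of nonnegative functions; \<open>v - G v / 2\<close> is then the nearest point.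
\<close>

locale lyapunov_functional =
  fixes \<Phi> :: "(real \<Rightarrow> real) \<Rightarrow> real" and G :: "(real \<Rightarrow> real) \<Rightarrow> real \<Rightarrow> real" and K :: real
  assumes G_L2_I: "v \<in> L2_I \<Longrightarrow> G v \<in> L2_I"
    and lower: "v \<in> L2_I \<Longrightarrow> v' \<in> L2_I \<Longrightarrow> \<Phi> v + L2_inner (G v) (\<lambda>x. v' x - v x) \<le> \<Phi> v'"
    and upper: "v \<in> L2_I \<Longrightarrow> v' \<in> L2_I \<Longrightarrow>
      \<Phi> v' \<le> \<Phi> v + L2_inner (G v) (\<lambda>x. v' x - v x) + (L2_dist v' v)\<^sup>2"
    and energy: "v \<in> L2_I \<Longrightarrow> directed_energy (\<lambda>x. v x - G v x / 2) \<le> directed_energy v"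
    and G_bound: "v \<in> L2_I \<Longrightarrow> L2_norm (G v) \<le> 2 * L2_norm v + K"
begin

text \<open>The subgradient inequality is tested at \<open>v - G v / 2\<close>. Its energy is no
  larger than that of \<open>v\<close>, so the linear term there cannot be positive. Hence
  \<open>\<Phi>\<close> does not increase to first order in the direction
  \<open>- \<xi>\<close>.\<close>

lemma inner_subdifferential_nonneg:
  assumes \<xi>: "\<xi> \<in> subdifferential directed_energy v"
  shows "0 \<le> L2_inner (G v) \<xi>"
proof -
  let ?E = "directed_energy"
  have v: "v \<in> L2_I" "\<xi> \<in> L2_I" "?E v < \<infinity>" using \<xi> by (auto simp: subdifferential_def)
  have g: "(\<lambda>x. v x - G v x / 2) \<in> L2_I"
    using L2_I_diff[OF v(1) L2_I_cmult[OF G_L2_I[OF v(1)], of "1/2"]] by simp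
  have "?E v + ereal (L2_inner \<xi> (\<lambda>x. (v x - G v x / 2) - v x)) \<le> ?E (\<lambda>x. v x - G v x / 2)"
    using \<xi> g by (auto simp: subdifferential_def)
  also have "\<dots> \<le> ?E v" by (rule energy[OF v(1)])
  finally have "L2_inner \<xi> (\<lambda>x. (v x - G v x / 2) - v x) \<le> 0"
    using v(3) directed_energy_nonneg[of v] by (cases "?E v") auto
  moreover have "L2_inner \<xi> (\<lambda>x. (v x - G v x / 2) - v x) = - (1/2) * L2_inner (G v) \<xi>"
    using L2_inner_cmult_right[of \<xi> "- (1/2)" "G v"] by (simp add: L2_inner_commute)
  ultimately show ?thesis by simp
qed

text \<open>The expansion \<open>W (t + h) = W t + h (r h - \<xi>)\<close> with \<open>r h\<close>
  tending to 0 is inserted into the bounds on \<open>\<Phi>\<close> at \<open>W t\<close>. The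
  forward step uses \<open>upper\<close> and has a quadratic remainder; the backward step uses
  \<open>lower\<close>, which is free of one.\<close>

lemma increments_small:
  assumes \<xi>: "\<xi> \<in> subdifferential directed_energy (W t)" and d: "has_L2_deriv W (\<lambda>x. - \<xi> x) t"
    and W: "\<And>s. 0 \<le> s \<Longrightarrow> W s \<in> L2_I" and t: "0 < t" and e: "0 < e"
  shows "\<exists>d>0. \<forall>h. 0 < h \<and> h < d \<longrightarrow>
    \<Phi> (W (t + h)) \<le> \<Phi> (W t) + e * h \<and> \<Phi> (W t) \<le> \<Phi> (W (t - h)) + e * h"
proof -
  have Wt: "W t \<in> L2_I" using W t by simp
  have \<xi>2: "\<xi> \<in> L2_I" using \<xi> by (simp add: subdifferential_def)
  define r where "r h = (\<lambda>x. (W (t + h) x - W t x) / h - (- \<xi> x))" for h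
  define \<rho> where "\<rho> h = L2_norm (r h)" for h
  have lim: "(\<rho> \<longlongrightarrow> 0) (at 0)"
    using d by (simp add: has_L2_deriv_def L2_dist_def \<rho>_def[abs_def] r_def)
  define g where "g = L2_norm (G (W t))"
  define k where "k = L2_norm \<xi>"
  \<comment> \<open>The total error divided by the step: the first term bounds the pairing of the
    gradient with \<open>r h\<close>, the second is the quadratic remainder over
    \<open>\<bar>h\<bar>\<close>.\<close>
  have "((\<lambda>h. g * \<rho> h + \<bar>h\<bar> * (k + \<rho> h)\<^sup>2) \<longlongrightarrow> g * 0 + \<bar>0\<bar> * (k + 0)\<^sup>2) (at 0)"
    by (intro tendsto_intros lim)
  then have "\<forall>\<^sub>F h in at 0. g * \<rho> h + \<bar>h\<bar> * (k + \<rho> h)\<^sup>2 < e"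
    using e by (intro order_tendstoD(2)) auto
  then obtain d0 where "0 < d0"
    and "\<forall>h\<in>UNIV. h \<noteq> 0 \<and> dist h 0 < d0 \<longrightarrow> g * \<rho> h + \<bar>h\<bar> * (k + \<rho> h)\<^sup>2 < e"
    unfolding eventually_at by blast
  then have d0: "0 < d0" "\<And>h. h \<noteq> 0 \<Longrightarrow> \<bar>h\<bar> < d0 \<Longrightarrow> g * \<rho> h + \<bar>h\<bar> * (k + \<rho> h)\<^sup>2 < e"
    by (simp_all add: dist_real_def)
  have r2: "r h \<in> L2_I" if "0 \<le> t + h" for h
  proof -
    have "(\<lambda>x. (1 / h) * (W (t + h) x - W t x) - (- \<xi> x)) \<in> L2_I"
      using W[OF that] Wt \<xi>2 by (intro L2_I_diff L2_I_cmult L2_I_uminus)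
    then show ?thesis by (simp add: r_def)
  qed
  have inner: "L2_inner (G (W t)) (\<lambda>x. W (t + h) x - W t x) = h * (L2_inner (G (W t)) (r h) - L2_inner (G (W t)) \<xi>)"
    if "0 \<le> t + h" "h \<noteq> 0" for h
  proof -
    have eq: "(\<lambda>x. W (t + h) x - W t x) = (\<lambda>x. h * (r h x - \<xi> x))"
      using that by (simp add: r_def fun_eq_iff)
    show ?thesis unfolding eq using r2[OF that(1)] \<xi>2 G_L2_I[OF Wt]
      by (simp add: L2_inner_cmult_right L2_inner_diff_right)
  qed
  have abs_inner: "\<bar>L2_inner (G (W t)) (r h)\<bar> \<le> g * \<rho> h" if "0 \<le> t + h" for h
    unfolding g_def \<rho>_def by (rule L2_Cauchy_Schwarz[OF G_L2_I[OF Wt] r2[OF that]])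
  have nonneg: "0 \<le> L2_inner (G (W t)) \<xi>" by (rule inner_subdifferential_nonneg[OF \<xi>])
  have "\<Phi> (W (t + h)) \<le> \<Phi> (W t) + e * h" if h: "0 < h" "h < min d0 t" for h
  proof -
    have th: "0 \<le> t + h" using h t by simp
    have "L2_dist (W (t + h)) (W t) = L2_norm (\<lambda>x. h * (r h x + (- \<xi> x)))"
      using h by (simp add: L2_dist_def r_def)
    also have "\<dots> = h * L2_norm (\<lambda>x. r h x + (- \<xi> x))" using h by (subst L2_norm_cmult) simp
    also have "\<dots> \<le> h * (\<rho> h + k)"
      using L2_norm_triangle[OF r2[OF th] L2_I_uminus[OF \<xi>2]] L2_norm_cmult[of "-1" \<xi>] h
      by (intro mult_left_mono) (auto simp: \<rho>_def k_def)
    finally have "(L2_dist (W (t + h)) (W t))\<^sup>2 \<le> (h * (\<rho> h + k))\<^sup>2" by (intro power_mono) auto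
    also have "\<dots> = h * (h * (k + \<rho> h)\<^sup>2)" by (simp add: power_mult_distrib power2_eq_square algebra_simps)
    finally have sq: "(L2_dist (W (t + h)) (W t))\<^sup>2 \<le> h * (h * (k + \<rho> h)\<^sup>2)" .
    have "\<Phi> (W (t + h)) \<le> \<Phi> (W t) + h * (L2_inner (G (W t)) (r h) - L2_inner (G (W t)) \<xi>) + h * (h * (k + \<rho> h)\<^sup>2)"
      using upper[OF Wt W[OF th]] inner[OF th] h sq by simp
    also have "\<dots> \<le> \<Phi> (W t) + h * (g * \<rho> h) + h * (h * (k + \<rho> h)\<^sup>2)"
      using abs_inner[OF th] nonneg h by (intro add_mono mult_left_mono) auto
    also have "\<dots> = \<Phi> (W t) + h * (g * \<rho> h + \<bar>h\<bar> * (k + \<rho> h)\<^sup>2)" using h by (simp add: algebra_simps)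
    also have "\<dots> \<le> \<Phi> (W t) + h * e"
      using d0(2)[of h] h by (intro add_left_mono mult_left_mono) auto
    finally show ?thesis by (simp add: mult.commute)
  qed
  moreover have "\<Phi> (W t) \<le> \<Phi> (W (t - h)) + e * h" if h: "0 < h" "h < min d0 t" for h
  proof -
    have th: "0 \<le> t + (- h)" using h by simp
    have "\<Phi> (W t) + (- h) * (L2_inner (G (W t)) (r (- h)) - L2_inner (G (W t)) \<xi>) \<le> \<Phi> (W (t + (- h)))"
      using lower[OF Wt W[OF th]] inner[OF th] h by simp
    moreover have "h * (L2_inner (G (W t)) (r (- h)) - L2_inner (G (W t)) \<xi>) \<le> h * e"
    proof (rule mult_left_mono)
      have "0 \<le> \<bar>- h\<bar> * (k + \<rho> (- h))\<^sup>2" by simp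
      moreover have "g * \<rho> (- h) + \<bar>- h\<bar> * (k + \<rho> (- h))\<^sup>2 < e" using h by (intro d0(2)) auto
      ultimately show "L2_inner (G (W t)) (r (- h)) - L2_inner (G (W t)) \<xi> \<le> e"
        using abs_inner[OF th] nonneg by linarith
    qed (use h in simp)
    ultimately show ?thesis by (simp add: mult.commute)
  qed
  ultimately show ?thesis using d0(1) t by (intro exI[of _ "min d0 t"]) auto
qed

text \<open>The initial time is positive because absolute continuity is given only away from 0; the
  time 0 is reached afterwards by continuity.\<close>

lemma gradient_flow_nonincreasing:
  assumes flow: "gradient_flow w W" and ab: "0 < a" "a < b"
  shows "\<Phi> (W b) \<le> \<Phi> (W a)"
proof -
  have W: "W t \<in> L2_I" if "0 \<le> t" for t using flow that by (simp add: gradient_flow_def)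
  have "L2_abs_continuous_on a b W" using flow ab by (simp add: gradient_flow_def)
  then obtain m where m: "set_integrable lborel {a..b} m"
    and ac: "\<And>s t. a \<le> s \<Longrightarrow> s \<le> t \<Longrightarrow> t \<le> b \<Longrightarrow> L2_dist (W t) (W s) \<le> (LINT r:{s..t}|lborel. m r)"
    unfolding L2_abs_continuous_on_def by blast
  \<comment> \<open>A bound for the norms along the curve. Through \<open>G_bound\<close> it makes
    \<open>2 * R + K\<close> a bound for the gradients, which turns the modulus \<open>m\<close> of
    the curve into one for \<open>\<Phi>\<close>.\<close>
  define R where "R = L2_norm (W a) + (LINT r:{a..b}|lborel. \<bar>m r\<bar>)"
  have R: "L2_norm (W t) \<le> R" if t: "a \<le> t" "t \<le> b" for t
  proof -
    have "L2_norm (W t) \<le> L2_norm (W a) + L2_dist (W t) (W a)"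
      using L2_norm_triangle[of "W a" "\<lambda>x. W t x - W a x"] W ab t by (simp add: L2_dist_def L2_I_diff)
    also have "L2_dist (W t) (W a) \<le> (LINT r:{a..t}|lborel. m r)" using ac[of a t] t by simp
    also have "\<dots> \<le> (LINT r:{a..b}|lborel. \<bar>m r\<bar>)"
      unfolding set_lebesgue_integral_def
    proof (rule integral_mono)
      have "set_integrable lborel {a..t} m" by (rule set_integrable_subset[OF m]) (use t in auto)
      then show "integrable lborel (\<lambda>r. indicator {a..t} r *\<^sub>R m r)" by (simp add: set_integrable_def)
      show "integrable lborel (\<lambda>r. indicator {a..b} r *\<^sub>R \<bar>m r\<bar>)"
        using set_integrable_abs[OF m] by (simp add: set_integrable_def)
      show "indicator {a..t} r *\<^sub>R m r \<le> indicator {a..b} r *\<^sub>R \<bar>m r\<bar>" for r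
        using t by (auto split: split_indicator)
    qed
    finally show ?thesis by (simp add: R_def)
  qed
  show ?thesis
  proof (rule nonincreasing_if_AE_derivative_nonpos[where q = "\<lambda>t. \<Phi> (W t)" and m = "\<lambda>r. (2 * R + K) * m r"])
    show "a \<le> b" using ab by simp
    show "set_integrable lborel {a..b} (\<lambda>r. (2 * R + K) * m r)" using m by simp
    fix s t assume st: "a \<le> s" "s \<le> t" "t \<le> b"
    have Wst: "W s \<in> L2_I" "W t \<in> L2_I" using W st ab by auto
    \<comment> \<open>Convexity at the later point \<open>W t\<close> bounds the increment from
      above, the one direction that the scalar lemma asks for.\<close>
    have "\<Phi> (W t) - \<Phi> (W s) \<le> - L2_inner (G (W t)) (\<lambda>x. W s x - W t x)"
      using lower[OF Wst(2,1)] by simp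
    also have "\<dots> \<le> L2_norm (G (W t)) * L2_dist (W s) (W t)"
      using L2_Cauchy_Schwarz[OF G_L2_I[OF Wst(2)] L2_I_diff[OF Wst]] by (simp add: L2_dist_def abs_le_iff)
    also have "\<dots> \<le> (2 * R + K) * (LINT r:{s..t}|lborel. m r)"
    proof (rule mult_mono)
      show "L2_norm (G (W t)) \<le> 2 * R + K" using G_bound[OF Wst(2)] R[of t] st by simp
      then show "0 \<le> 2 * R + K" using L2_norm_nonneg order.trans by blast
      show "L2_dist (W s) (W t) \<le> (LINT r:{s..t}|lborel. m r)"
        using ac[OF st] by (simp add: L2_dist_commute)
    qed simp
    finally show "\<Phi> (W t) - \<Phi> (W s) \<le> (LINT r:{s..t}|lborel. (2 * R + K) * m r)" by simp
  next
    have "AE t in lborel. 0 < t \<longrightarrow>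
        (\<exists>\<xi> \<in> subdifferential directed_energy (W t). has_L2_deriv W (\<lambda>x. - \<xi> x) t)"
      using flow by (simp add: gradient_flow_def)
    then show "AE t in lborel. a \<le> t \<and> t \<le> b \<longrightarrow>
      (\<forall>e>0. \<exists>d>0. \<forall>h. 0 < h \<and> h < d \<longrightarrow>
        (t + h \<le> b \<longrightarrow> \<Phi> (W (t + h)) \<le> \<Phi> (W t) + e * h) \<and>
        (a \<le> t - h \<longrightarrow> \<Phi> (W t) \<le> \<Phi> (W (t - h)) + e * h))"
    proof eventually_elim
      fix t assume *: "0 < t \<longrightarrow> (\<exists>\<xi> \<in> subdifferential directed_energy (W t). has_L2_deriv W (\<lambda>x. - \<xi> x) t)"
      show "a \<le> t \<and> t \<le> b \<longrightarrow>
      (\<forall>e>0. \<exists>d>0. \<forall>h. 0 < h \<and> h < d \<longrightarrow>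
        (t + h \<le> b \<longrightarrow> \<Phi> (W (t + h)) \<le> \<Phi> (W t) + e * h) \<and>
        (a \<le> t - h \<longrightarrow> \<Phi> (W t) \<le> \<Phi> (W (t - h)) + e * h))"
      proof (intro impI allI)
        fix e :: real assume "a \<le> t \<and> t \<le> b" and e: "0 < e"
        then have t: "0 < t" using ab by simp
        with * obtain \<xi> where "\<xi> \<in> subdifferential directed_energy (W t)" "has_L2_deriv W (\<lambda>x. - \<xi> x) t"
          by blast
        from increments_small[OF this W t e]
        show "\<exists>d>0. \<forall>h. 0 < h \<and> h < d \<longrightarrow>
          (t + h \<le> b \<longrightarrow> \<Phi> (W (t + h)) \<le> \<Phi> (W t) + e * h) \<and>
          (a \<le> t - h \<longrightarrow> \<Phi> (W t) \<le> \<Phi> (W (t - h)) + e * h)" by blast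
      qed
    qed
  qed
qed

lemma continuity:
  assumes "v \<in> L2_I" "v' \<in> L2_I"
  shows "\<Phi> v' \<le> \<Phi> v + L2_norm (G v) * L2_dist v' v + (L2_dist v' v)\<^sup>2"
  using upper[OF assms] L2_Cauchy_Schwarz[OF G_L2_I[OF assms(1)] L2_I_diff[OF assms(2,1)]]
  by (simp add: L2_dist_def abs_le_iff)

lemma gradient_flow_le_initial:
  assumes flow: "gradient_flow w W" and w: "w \<in> L2_I" and t: "0 < t"
  shows "\<Phi> (W t) \<le> \<Phi> w"
proof -
  have lim: "((\<lambda>a. L2_dist (W a) w) \<longlongrightarrow> 0) (at_right 0)"
    using flow by (simp add: gradient_flow_def)
  have "((\<lambda>a. \<Phi> w + L2_norm (G w) * L2_dist (W a) w + (L2_dist (W a) w)\<^sup>2)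
      \<longlongrightarrow> \<Phi> w + L2_norm (G w) * 0 + 0\<^sup>2) (at_right 0)"
    by (intro tendsto_intros lim)
  then have lim': "((\<lambda>a. \<Phi> w + L2_norm (G w) * L2_dist (W a) w + (L2_dist (W a) w)\<^sup>2) \<longlongrightarrow> \<Phi> w) (at_right 0)"
    by simp
  show ?thesis
  proof (rule tendsto_lowerbound[OF lim'])
    show "\<forall>\<^sub>F a in at_right 0. \<Phi> (W t) \<le> \<Phi> w + L2_norm (G w) * L2_dist (W a) w + (L2_dist (W a) w)\<^sup>2"
      using eventually_at_right_real[OF t]
    proof eventually_elim
      fix a assume a: "a \<in> {0<..<t}"
      then have "\<Phi> (W t) \<le> \<Phi> (W a)" by (intro gradient_flow_nonincreasing[OF flow]) auto
      also have "\<dots> \<le> \<Phi> w + L2_norm (G w) * L2_dist (W a) w + (L2_dist (W a) w)\<^sup>2"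
        using flow a by (intro continuity w) (simp add: gradient_flow_def)
      finally show "\<Phi> (W t) \<le> \<Phi> w + L2_norm (G w) * L2_dist (W a) w + (L2_dist (W a) w)\<^sup>2" .
    qed
  qed simp
qed

text \<open>As \<open>u\<close> is decomposable, \<open>is_P\<close> speaks of flows that start from
  \<open>u\<close> itself. It may supply a different flow for every \<open>t\<close>, which is
  harmless because each is compared with \<open>u\<close> only.\<close>

lemma P_infinity_le_initial:
  assumes u: "u \<in> decomposable" and v: "is_P_infinity u v"
  shows "\<Phi> v \<le> \<Phi> u"
proof -
  have vL: "v \<in> L2_I" using v by (simp add: is_P_infinity_def)
  obtain p where p: "\<And>t. 0 \<le> t \<Longrightarrow> is_P t u (p t)" and lim: "((\<lambda>t. L2_dist (p t) v) \<longlongrightarrow> 0) at_top"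
    using v by (auto simp: is_P_infinity_def)
  have "((\<lambda>t. \<Phi> u + L2_norm (G v) * L2_dist (p t) v) \<longlongrightarrow> \<Phi> u + L2_norm (G v) * 0) at_top"
    by (intro tendsto_intros lim)
  then have lim': "((\<lambda>t. \<Phi> u + L2_norm (G v) * L2_dist (p t) v) \<longlongrightarrow> \<Phi> u) at_top" by simp
  show ?thesis
  proof (rule tendsto_lowerbound[OF lim'])
    show "\<forall>\<^sub>F t in at_top. \<Phi> v \<le> \<Phi> u + L2_norm (G v) * L2_dist (p t) v"
      using eventually_gt_at_top[of 0]
    proof eventually_elim
      fix t :: real assume t: "0 < t"
      then obtain W where W: "gradient_flow u W" "AE x in leb_I. p t x = W t x"
        and L2: "u \<in> L2_I" "p t \<in> L2_I"
        using p[of t] u by (auto simp: is_P_def)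
      have Wt: "W t \<in> L2_I" using W(1) t by (simp add: gradient_flow_def)
      have "L2_dist (p t) (W t) = L2_norm (\<lambda>x. 0)"
        unfolding L2_dist_def using L2 Wt W(2)
        by (intro L2_norm_cong_AE) (auto intro!: L2_I_measurable L2_I_diff)
      then have "\<Phi> (p t) \<le> \<Phi> (W t)" using continuity[OF Wt L2(2)] by (simp add: L2_norm_def)
      also have "\<dots> \<le> \<Phi> u" by (rule gradient_flow_le_initial[OF W(1) L2(1) t])
      finally have "\<Phi> (p t) \<le> \<Phi> u" .
      \<comment> \<open>Convexity at the limit \<open>v\<close>: its gradient does not depend on
        \<open>t\<close>, so the error vanishes as \<open>t\<close> grows.\<close>
      moreover have "\<Phi> v \<le> \<Phi> (p t) + L2_norm (G v) * L2_dist (p t) v"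
        using lower[OF vL L2(2)] L2_Cauchy_Schwarz[OF G_L2_I[OF vL] L2_I_diff[OF L2(2) vL]]
        by (simp add: L2_dist_def abs_le_iff)
      ultimately show "\<Phi> v \<le> \<Phi> u + L2_norm (G v) * L2_dist (p t) v" by simp
    qed
  qed simp
qed

end

text \<open>The squared distance expands exactly, with remainder
  \<open>(L2_dist v' v)\<^sup>2\<close>: \<open>upper\<close> is an equality and
  \<open>lower\<close> drops the remainder. The test point \<open>v - G v / 2\<close> is
  \<open>z\<close>, whose energy is 0.\<close>

lemma lyapunov_functional_dist:
  assumes z: "z \<in> L2_I" "ae_nondecreasing z"
  shows "lyapunov_functional (\<lambda>v. (L2_dist v z)\<^sup>2) (\<lambda>v x. 2 * (v x - z x)) (2 * L2_norm z)"
proof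
  fix v assume v: "v \<in> L2_I"
  have vz: "(\<lambda>x. v x - z x) \<in> L2_I" using v z by (intro L2_I_diff)
  then show "(\<lambda>x. 2 * (v x - z x)) \<in> L2_I" by (rule L2_I_cmult)
  have eq: "(L2_dist v' z)\<^sup>2 = (L2_dist v z)\<^sup>2 + L2_inner (\<lambda>x. 2 * (v x - z x)) (\<lambda>x. v' x - v x) + (L2_dist v' v)\<^sup>2"
    if v': "v' \<in> L2_I" for v'
    using L2_norm_add_power2[OF vz L2_I_diff[OF v' v]] L2_inner_cmult_right[of "\<lambda>x. v' x - v x" 2 "\<lambda>x. v x - z x"]
    by (simp add: L2_dist_def L2_inner_commute)
  show "(L2_dist v z)\<^sup>2 + L2_inner (\<lambda>x. 2 * (v x - z x)) (\<lambda>x. v' x - v x) \<le> (L2_dist v' z)\<^sup>2"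
    and "(L2_dist v' z)\<^sup>2 \<le> (L2_dist v z)\<^sup>2 + L2_inner (\<lambda>x. 2 * (v x - z x)) (\<lambda>x. v' x - v x) + (L2_dist v' v)\<^sup>2"
    if v': "v' \<in> L2_I" for v'
    using eq[OF v'] by simp_all
  have "(\<lambda>x. v x - 2 * (v x - z x) / 2) = z" by (intro ext) (simp add: field_simps)
  then show "directed_energy (\<lambda>x. v x - 2 * (v x - z x) / 2) \<le> directed_energy v"
    using directed_energy_nondecreasing[OF z] directed_energy_nonneg[of v] by simp
  show "L2_norm (\<lambda>x. 2 * (v x - z x)) \<le> 2 * L2_norm v + 2 * L2_norm z"
    using L2_norm_triangle[OF v L2_I_uminus[OF z(1)]] L2_norm_cmult[of "-1" z]
    by (subst L2_norm_cmult) simp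
qed

text \<open>Both bounds are integrated from the scalar function \<open>(min s 0)\<^sup>2\<close>,
  which is convex with derivative \<open>2 * min s 0\<close>. The test point is the positive part of
  \<open>v\<close>.\<close>

lemma lyapunov_functional_negative_part:
  "lyapunov_functional (\<lambda>v. (L2_norm (\<lambda>x. min (v x) 0))\<^sup>2) (\<lambda>v x. 2 * min (v x) 0) 0"
proof
  have min: "(\<lambda>x. min (v x) 0) \<in> L2_I" if v: "v \<in> L2_I" for v :: "real \<Rightarrow> real"
  proof -
    have "(\<lambda>x. - max (- v x) 0) \<in> L2_I" using v by (intro L2_I_uminus L2_I_max L2_I_const)
    moreover have "(\<lambda>x. - max (- v x) 0) = (\<lambda>x. min (v x) 0)" by (auto simp: fun_eq_iff min_def max_def)
    ultimately show ?thesis by simp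
  qed
  fix v :: "real \<Rightarrow> real" assume v: "v \<in> L2_I"
  show G: "(\<lambda>x. 2 * min (v x) 0) \<in> L2_I" using min[OF v] by (rule L2_I_cmult)
  have point: "(min a 0)\<^sup>2 + 2 * min a 0 * (b - a) \<le> (min b 0)\<^sup>2"
    "(min b 0)\<^sup>2 \<le> (min a 0)\<^sup>2 + 2 * min a 0 * (b - a) + (b - a)\<^sup>2" for a b :: real
  proof -
    \<comment> \<open>The convexity gap as a square plus a product. Since
      \<open>min a 0 - a = - max a 0\<close> and \<open>min a 0 * max a 0 = 0\<close>, the product
      is \<open>- 2 * min a 0 * max b 0\<close>, which is nonnegative.\<close>
    have 1: "(min b 0)\<^sup>2 - (min a 0)\<^sup>2 - 2 * min a 0 * (b - a)
        = (min b 0 - min a 0)\<^sup>2 + 2 * min a 0 * ((min b 0 - b) - (min a 0 - a))"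
      by (simp add: power2_eq_square algebra_simps)
    have 2: "0 \<le> 2 * min a 0 * ((min b 0 - b) - (min a 0 - a))"
      by (cases "a \<le> 0"; cases "b \<le> 0") (auto simp: min_def mult_nonpos_nonpos mult_nonpos_nonneg)
    show "(min a 0)\<^sup>2 + 2 * min a 0 * (b - a) \<le> (min b 0)\<^sup>2" using 1 2 zero_le_power2[of "min b 0 - min a 0"] by linarith
    show "(min b 0)\<^sup>2 \<le> (min a 0)\<^sup>2 + 2 * min a 0 * (b - a) + (b - a)\<^sup>2"
    proof -
      have "(min a 0)\<^sup>2 + 2 * min a 0 * (b - a) + (b - a)\<^sup>2 = (min a 0 + (b - a))\<^sup>2" 
        by (simp add: power2_sum)
      \<comment> \<open>Here \<open>min a 0 + (b - a) = b - max a 0 \<le> b\<close>, so for negative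
        \<open>b\<close> it lies at least as far from 0 as \<open>b\<close>.\<close>
      moreover have "\<bar>min b 0\<bar> \<le> \<bar>min a 0 + (b - a)\<bar>" by (auto simp: min_def)
      ultimately show ?thesis by (simp only: abs_le_square_iff)
    qed
  qed
  fix v' :: "real \<Rightarrow> real" assume v': "v' \<in> L2_I"
  have d: "(\<lambda>x. v' x - v x) \<in> L2_I" using v' v by (rule L2_I_diff)
  have int: "integrable leb_I (\<lambda>x. (min (v x) 0)\<^sup>2)" "integrable leb_I (\<lambda>x. (min (v' x) 0)\<^sup>2)"
    "integrable leb_I (\<lambda>x. 2 * min (v x) 0 * (v' x - v x))" "integrable leb_I (\<lambda>x. (v' x - v x)\<^sup>2)"
    using L2_I_square[OF min[OF v]] L2_I_square[OF min[OF v']] L2_I_mult[OF G d] L2_I_square[OF d] by auto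
  have "(LINT x|leb_I. (min (v x) 0)\<^sup>2 + 2 * min (v x) 0 * (v' x - v x)) \<le> (LINT x|leb_I. (min (v' x) 0)\<^sup>2)"
    using int by (intro integral_mono Bochner_Integration.integrable_add point)
  then show "(L2_norm (\<lambda>x. min (v x) 0))\<^sup>2 + L2_inner (\<lambda>x. 2 * min (v x) 0) (\<lambda>x. v' x - v x)
      \<le> (L2_norm (\<lambda>x. min (v' x) 0))\<^sup>2"
    using int by (simp add: L2_norm_power2 L2_inner_def)
  have "(LINT x|leb_I. (min (v' x) 0)\<^sup>2) \<le> (LINT x|leb_I. (min (v x) 0)\<^sup>2 + 2 * min (v x) 0 * (v' x - v x) + (v' x - v x)\<^sup>2)"
    using int by (intro integral_mono Bochner_Integration.integrable_add point)
  then show "(L2_norm (\<lambda>x. min (v' x) 0))\<^sup>2 \<le> (L2_norm (\<lambda>x. min (v x) 0))\<^sup>2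
      + L2_inner (\<lambda>x. 2 * min (v x) 0) (\<lambda>x. v' x - v x) + (L2_dist v' v)\<^sup>2"
    using int by (simp add: L2_dist_def L2_norm_power2 L2_inner_def)
next
  fix v :: "real \<Rightarrow> real" assume v: "v \<in> L2_I"
  have "(\<lambda>x. v x - 2 * min (v x) 0 / 2) = (\<lambda>x. max (v x) 0)" by (auto simp: min_def max_def)
  then show "directed_energy (\<lambda>x. v x - 2 * min (v x) 0 / 2) \<le> directed_energy v"
    using directed_energy_positive_part[OF v] by simp
  have [measurable]: "v \<in> borel_measurable leb_I" using v by (rule L2_I_measurable)
  have "(\<lambda>x. min (v x) 0) \<in> L2_I" by (rule L2_I_bound[OF v]) (auto simp: min_def)
  then have "(LINT x|leb_I. (min (v x) 0)\<^sup>2) \<le> (LINT x|leb_I. (v x)\<^sup>2)"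
    using v by (intro integral_mono L2_I_square) (auto simp: min_def)
  then have "L2_norm (\<lambda>x. min (v x) 0) \<le> L2_norm v" by (simp add: L2_norm_def)
  then show "L2_norm (\<lambda>x. 2 * min (v x) 0) \<le> 2 * L2_norm v + 0"
    by (subst L2_norm_cmult) simp
qed

section \<open>Properties of the limit of the flow\<close>

lemma P_infinity_dist_le:
  assumes "u \<in> decomposable" "is_P_infinity u v" "z \<in> L2_I" "ae_nondecreasing z"
  shows "L2_dist v z \<le> L2_dist u z"
proof -
  interpret lyapunov_functional "\<lambda>v. (L2_dist v z)\<^sup>2" "\<lambda>v x. 2 * (v x - z x)" "2 * L2_norm z"
    using assms(3,4) by (rule lyapunov_functional_dist)
  show ?thesis using P_infinity_le_initial[OF assms(1,2)] by (rule power2_le_imp_le) simp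
qed

text \<open>Needed because \<open>density_measure\<close> truncates negative values: only for a
  nonnegative \<open>v\<close> is its total mass the integral of \<open>v\<close>.\<close>

lemma P_infinity_nonneg:
  assumes u: "u \<in> decomposable" "AE x in leb_I. 0 \<le> u x" and v: "is_P_infinity u v"
  shows "AE x in leb_I. 0 \<le> v x"
proof -
  interpret lyapunov_functional "\<lambda>v. (L2_norm (\<lambda>x. min (v x) 0))\<^sup>2" "\<lambda>v x. 2 * min (v x) 0" 0
    by (rule lyapunov_functional_negative_part)
  have L2: "u \<in> L2_I" "v \<in> L2_I" using u v by (auto simp: decomposable_def is_P_infinity_def)
  have neg: "(\<lambda>x. min (w x) 0) \<in> L2_I" if "w \<in> L2_I" for w
    using L2_I_cmult[OF G_L2_I[OF that], of "1/2"] by simp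
  have "L2_norm (\<lambda>x. min (u x) 0) = L2_norm (\<lambda>x. 0)"
    using u(2) by (intro L2_norm_cong_AE L2_I_measurable neg L2) auto
  also have "\<dots> = 0" by (simp add: L2_norm_def)
  finally have "L2_norm (\<lambda>x. min (v x) 0) = 0"
    using P_infinity_le_initial[OF u(1) v] by simp
  then have "AE x in leb_I. min (v x) 0 = 0" by (intro L2_norm_eq_0_AE neg L2)
  then show ?thesis by eventually_elim (simp add: min_def split: if_splits)
qed

text \<open>Comparing the distances to large constants of either sign gives conservation of mass.\<close>

lemma P_infinity_mass:
  assumes u: "u \<in> decomposable" and v: "is_P_infinity u v"
  shows "(LINT x|leb_I. v x) = (LINT x|leb_I. u x)"
proof (rule ccontr)
  have L2: "u \<in> L2_I" "v \<in> L2_I" using u v by (auto simp: decomposable_def is_P_infinity_def)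
  define A B where "A = (LINT x|leb_I. u x)" and "B = (LINT x|leb_I. v x)"
  assume "(LINT x|leb_I. v x) \<noteq> (LINT x|leb_I. u x)"
  then have ne: "A - B \<noteq> 0" by (simp add: A_def B_def)
  \<comment> \<open>The parameter \<open>k\<close> meets \<open>w\<close> only through its mean, so
    large \<open>\<bar>k\<bar>\<close> isolates the difference of the means.\<close>
  have dist: "(L2_dist w (\<lambda>x. k))\<^sup>2 = (L2_norm w)\<^sup>2 - 2 * k * (LINT x|leb_I. w x) + k\<^sup>2" if "w \<in> L2_I" for w k
    using that leb_I.prob_space
    by (simp add: L2_dist_def L2_norm_power2 power2_diff L2_I_square L2_I_integrable mult.commute)
  have "2 * k * (A - B) \<le> (L2_norm u)\<^sup>2 - (L2_norm v)\<^sup>2" for k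
  proof -
    have "(L2_dist v (\<lambda>x. k))\<^sup>2 \<le> (L2_dist u (\<lambda>x. k))\<^sup>2"
      using P_infinity_dist_le[OF u v, of "\<lambda>x. k"] by (intro power_mono) auto
    then show ?thesis using L2 by (simp add: dist A_def B_def algebra_simps)
  qed
  \<comment> \<open>If the means differ, this \<open>k\<close> gives the left side any prescribed
    value \<open>X\<close>, which contradicts the fixed bound on the right.\<close>
  moreover have "2 * (X / (2 * (A - B))) * (A - B) = X" for X
    using ne by (simp add: nonzero_divide_eq_eq)
  ultimately have "X \<le> (L2_norm u)\<^sup>2 - (L2_norm v)\<^sup>2" for X by metis
  from this[of "(L2_norm u)\<^sup>2 - (L2_norm v)\<^sup>2 + 1"] show False by simp
qed

lemma P_infinity_dist_initial:
  assumes u: "u \<in> decomposable" and v: "is_P_infinity u v"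
  shows "(L2_dist v u)\<^sup>2 \<le> 8 * dirichlet (down_part u)"
proof -
  obtain w1 w2 where eq: "opt_decomp u = (w1, w2)" by fastforce
  with opt_decomp_minimal(1)[OF u] have "(w1, w2) \<in> decomps u" by simp
  note d = decompsD[OF this]
  have L2: "u \<in> L2_I" "v \<in> L2_I" using u v by (auto simp: decomposable_def is_P_infinity_def)
  have "L2_dist v u \<le> L2_dist v w1 + L2_dist w1 u" by (rule L2_dist_triangle[OF L2(2) d(1) L2(1)])
  also have "\<dots> \<le> 2 * L2_dist u w1"
    using P_infinity_dist_le[OF u v d(1,4)] by (simp add: L2_dist_commute)
  also have "L2_dist u w1 = L2_norm w2"
    unfolding L2_dist_def
  proof (rule L2_norm_cong_AE)
    show "AE x in leb_I. u x - w1 x = w2 x" using d(7) by eventually_elim simp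
  qed (use L2 d in \<open>auto intro!: L2_I_measurable L2_I_diff\<close>)
  also have "L2_norm w2 \<le> L2_norm (weak_deriv w2)" by (rule Poincare_inequality[OF d(2,6)])
  finally have "(L2_dist v u)\<^sup>2 \<le> (2 * L2_norm (weak_deriv w2))\<^sup>2" by (intro power_mono) auto
  \<comment> \<open>The origin of the final constant: 4 from squaring the factor 2, and another 2
    because the energy is half the squared norm.\<close>
  also have "\<dots> = 8 * dirichlet w2" by (simp add: dirichlet_eq[OF d(2)] power_mult_distrib)
  finally show ?thesis by (simp add: down_part_def eq)
qed

section \<open>Transport in one dimension\<close>

text \<open>Represents a squared distance as an integral over the segment between \<open>p\<close>
  and \<open>q\<close>, with the weight measured from \<open>p\<close>. It is used horizontally for
  the two quantiles and vertically for the two distribution functions.\<close>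

lemma nn_integral_abs_diff:
  fixes p q :: real
  shows "(\<integral>\<^sup>+x. ennreal (if min p q \<le> x \<and> x \<le> max p q then 2 * \<bar>x - p\<bar> else 0) \<partial>lborel) = ennreal ((p - q)\<^sup>2)"
proof (cases "p \<le> q")
  case True
  have "(\<integral>\<^sup>+x. ennreal (2 * (x - p)) * indicator {p..q} x \<partial>lborel) = ennreal ((q - p)\<^sup>2 - (p - p)\<^sup>2)"
    using True by (intro nn_integral_FTC_Icc[where F = "\<lambda>x. (x - p)\<^sup>2"]) (auto intro!: derivative_eq_intros)
  moreover have "(\<integral>\<^sup>+x. ennreal (if min p q \<le> x \<and> x \<le> max p q then 2 * \<bar>x - p\<bar> else 0) \<partial>lborel)
      = (\<integral>\<^sup>+x. ennreal (2 * (x - p)) * indicator {p..q} x \<partial>lborel)"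
    using True by (intro nn_integral_cong) (auto split: split_indicator)
  ultimately show ?thesis by (simp add: power2_commute)
next
  case False
  have "(\<integral>\<^sup>+x. ennreal (2 * (p - x)) * indicator {q..p} x \<partial>lborel) = ennreal (- ((p - p)\<^sup>2) - - ((p - q)\<^sup>2))"
    using False by (intro nn_integral_FTC_Icc[where F = "\<lambda>x. - ((p - x)\<^sup>2)"]) (auto intro!: derivative_eq_intros)
  moreover have "(\<integral>\<^sup>+x. ennreal (if min p q \<le> x \<and> x \<le> max p q then 2 * \<bar>x - p\<bar> else 0) \<partial>lborel)
      = (\<integral>\<^sup>+x. ennreal (2 * (p - x)) * indicator {q..p} x \<partial>lborel)"
    using False by (intro nn_integral_cong) (auto split: split_indicator)
  ultimately show ?thesis by simp
qed

text \<open>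
  Both integrals are taken over the region between the graphs of the two distribution functions:
  by the slope condition the horizontal distance to the graph of \<open>cdf \<mu>\<close> is at most
  \<open>1 / c\<close> times the vertical one.
\<close>

lemma W2_squared_le_cdf:
  assumes "real_distribution \<mu>" "real_distribution \<nu>" and c: "0 < c"
    and slope: "\<And>x y. 0 \<le> x \<Longrightarrow> x \<le> y \<Longrightarrow> y \<le> 1 \<Longrightarrow> c * (y - x) \<le> cdf \<mu> y - cdf \<mu> x"
    and ends: "cdf \<mu> 0 = 0" "cdf \<mu> 1 = 1" "cdf \<nu> 0 = 0" "cdf \<nu> 1 = 1"
  shows "W2_squared \<mu> \<nu> \<le> (\<integral>\<^sup>+x. ennreal ((cdf \<mu> x - cdf \<nu> x)\<^sup>2 / c) \<partial>leb_I)"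
proof -
  interpret M: real_distribution \<mu> by fact
  interpret N: real_distribution \<nu> by fact
  interpret M: cdf_distribution \<mu> ..
  interpret N: cdf_distribution \<nu> ..
  define F G where "F = cdf \<mu>" and "G = cdf \<nu>"
  \<comment> \<open>The quantile functions. Driving both by the same uniform variable
    \<open>\<omega>\<close> gives the monotone coupling of the two measures.\<close>
  define X Y where "X \<omega> = Inf {x. \<omega> \<le> F x}" and "Y \<omega> = Inf {x. \<omega> \<le> G x}" for \<omega>
  have X: "\<omega> \<le> F x \<longleftrightarrow> X \<omega> \<le> x" and Y: "\<omega> \<le> G x \<longleftrightarrow> Y \<omega> \<le> x" if "\<omega> \<in> I" for \<omega> x
    using that M.pseudoinverse[of \<omega> x] N.pseudoinverse[of \<omega> x] by (auto simp: X_def Y_def F_def G_def)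
  have [measurable]: "F \<in> borel_measurable borel" "G \<in> borel_measurable borel"
    using M.measurable_C N.measurable_C by (simp_all add: F_def G_def)
  have sets_eq: "sets leb_I = sets (restrict_space borel I)"
    by (simp add: sets_restrict_space)
  have XY [measurable]: "X \<in> borel_measurable leb_I" "Y \<in> borel_measurable leb_I"
    using M.measurable_CI N.measurable_CI
    unfolding measurable_cong_sets[OF sets_eq refl] by (simp_all add: X_def[abs_def] Y_def[abs_def] F_def G_def)
  define \<gamma> where "\<gamma> = distr leb_I (borel \<Otimes>\<^sub>M borel) (\<lambda>\<omega>. (X \<omega>, Y \<omega>))"
  have pair [measurable]: "(\<lambda>\<omega>. (X \<omega>, Y \<omega>)) \<in> leb_I \<rightarrow>\<^sub>M borel \<Otimes>\<^sub>M borel" by measurable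
  have sets: "sets \<mu> = sets borel" "sets \<nu> = sets borel" by simp_all
  have "distr leb_I borel X = \<mu>" "distr leb_I borel Y = \<nu>"
    using M.distr_I_eq_M N.distr_I_eq_M by (simp_all add: X_def[abs_def] Y_def[abs_def] F_def G_def)
  then have "distr \<gamma> \<mu> fst = \<mu>" "distr \<gamma> \<nu> snd = \<nu>"
    unfolding \<gamma>_def using distr_cong[OF refl sets(1), of leb_I X X] distr_cong[OF refl sets(2), of leb_I Y Y]
    by (simp_all add: distr_distr[OF _ pair] comp_def measurable_cong_sets[OF refl sets(1)] measurable_cong_sets[OF refl sets(2)])
  moreover have "sets \<gamma> = sets (\<mu> \<Otimes>\<^sub>M \<nu>)"
    by (simp add: \<gamma>_def cong: sets_pair_measure_cong)
  ultimately have \<gamma>: "\<gamma> \<in> couplings \<mu> \<nu>" by (simp add: couplings_def)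
  \<comment> \<open>The vertical integrand of \<open>nn_integral_abs_diff\<close> at abscissa
    \<open>x\<close>, with the weight measured from \<open>F x\<close> and scaled by the inverse
    slope.\<close>
  define k where "k x \<omega> = (1 / c) * (if min (F x) (G x) \<le> \<omega> \<and> \<omega> \<le> max (F x) (G x) then 2 * \<bar>\<omega> - F x\<bar> else 0)" for x \<omega>
  have [measurable]: "(\<lambda>z. k (fst z) (snd z)) \<in> borel_measurable (borel \<Otimes>\<^sub>M borel)"
    unfolding k_def by measurable
  have XY_range: "0 \<le> X \<omega>" "X \<omega> \<le> 1" "0 \<le> Y \<omega>" "Y \<omega> \<le> 1" if w: "\<omega> \<in> I" for \<omega>
  proof -
    show "X \<omega> \<le> 1" "Y \<omega> \<le> 1" using X[OF w, of 1] Y[OF w, of 1] ends w by (auto simp: F_def G_def)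
    have "\<not> X \<omega> \<le> 0" "\<not> Y \<omega> \<le> 0" using X[OF w, of 0] Y[OF w, of 0] ends w by (auto simp: F_def G_def)
    then show "0 \<le> X \<omega>" "0 \<le> Y \<omega>" by simp_all
  qed
  \<comment> \<open>The point \<open>x = Y \<omega>\<close> is excluded: if
    \<open>X \<omega> < Y \<omega>\<close>, then \<open>\<omega> \<le> G x\<close> and
    \<open>\<omega> \<le> F x\<close> both hold there, and \<open>\<omega>\<close> may lie off the
    vertical segment. For fixed \<open>\<omega>\<close> it is a null set.\<close>
  have point: "2 * \<bar>x - X \<omega>\<bar> \<le> k x \<omega>"
    if w: "\<omega> \<in> I" and x: "x \<in> I" "min (X \<omega>) (Y \<omega>) \<le> x" "x \<le> max (X \<omega>) (Y \<omega>)" "x \<noteq> Y \<omega>" for x \<omega>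
  proof -
    note r = XY_range[OF w]
    consider "Y \<omega> \<le> x" "x < X \<omega>" | "X \<omega> \<le> x" "x < Y \<omega>" | "x = X \<omega>"
    proof (cases "Y \<omega> \<le> X \<omega>")
      case True
      then have "Y \<omega> \<le> x" "x \<le> X \<omega>" using x(2,3) by simp_all
      then show thesis using that(1,3) by linarith
    next
      case False
      then have "X \<omega> \<le> x" "x \<le> Y \<omega>" using x(2,3) by simp_all
      then show thesis using that(2) x(4) by linarith
    qed
    then show ?thesis
    proof cases
      case 1
      then have FG: "F x < \<omega>" "\<omega> \<le> G x" using X[OF w, of x] Y[OF w, of x] by auto
      \<comment> \<open>At \<open>X \<omega>\<close> itself \<open>F\<close> is bounded only from
        below by \<open>\<omega>\<close>. The slope condition is therefore used at points
        \<open>y\<close> to its left, where \<open>F y < \<omega>\<close>, and then \<open>y\<close>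
        tends to \<open>X \<omega>\<close>.\<close>
      have "X \<omega> \<le> x + (\<omega> - F x) / c"
      proof (rule dense_le_bounded[OF 1(2)])
        fix y assume y: "x < y" "y < X \<omega>"
        then have "F y < \<omega>" using X[OF w, of y] by auto
        moreover have "c * (y - x) \<le> F y - F x" unfolding F_def using x(1) y r by (intro slope) auto
        ultimately have "c * (y - x) \<le> \<omega> - F x" by simp
        then show "y \<le> x + (\<omega> - F x) / c" using c by (simp add: field_simps)
      qed
      then show ?thesis using 1 FG c by (simp add: k_def field_simps)
    next
      case 2
      then have FG: "G x < \<omega>" "\<omega> \<le> F x" using X[OF w, of x] Y[OF w, of x] by auto
      have "\<omega> \<le> F (X \<omega>)" using X[OF w, of "X \<omega>"] by simp
      moreover have "c * (x - X \<omega>) \<le> F x - F (X \<omega>)" unfolding F_def using x(1) 2 r by (intro slope) auto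
      ultimately have "c * (x - X \<omega>) \<le> F x - \<omega>" by simp
      then show ?thesis using 2 FG c by (simp add: k_def field_simps)
    next
      case 3
      then show ?thesis using c by (simp add: k_def)
    qed
  qed
  have "W2_squared \<mu> \<nu> \<le> (\<integral>\<^sup>+z. ennreal (\<bar>fst z - snd z\<bar>\<^sup>2) \<partial>\<gamma>)"
    unfolding W2_squared_def by (rule INF_lower[OF \<gamma>])
  also have "\<dots> = (\<integral>\<^sup>+\<omega>. ennreal ((X \<omega> - Y \<omega>)\<^sup>2) \<partial>leb_I)"
    unfolding \<gamma>_def by (subst nn_integral_distr) auto
  also have "\<dots> \<le> (\<integral>\<^sup>+\<omega>. (\<integral>\<^sup>+x. ennreal (k x \<omega>) * indicator I x \<partial>lborel) \<partial>leb_I)"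
  proof (rule nn_integral_mono)
    fix \<omega> assume "\<omega> \<in> space leb_I"
    then have w: "\<omega> \<in> I" by simp
    have "ennreal ((X \<omega> - Y \<omega>)\<^sup>2)
        = (\<integral>\<^sup>+x. ennreal (if min (X \<omega>) (Y \<omega>) \<le> x \<and> x \<le> max (X \<omega>) (Y \<omega>) then 2 * \<bar>x - X \<omega>\<bar> else 0) \<partial>lborel)"
      by (rule nn_integral_abs_diff[symmetric])
    also have "\<dots> \<le> (\<integral>\<^sup>+x. ennreal (k x \<omega>) * indicator I x \<partial>lborel)"
    proof (rule nn_integral_mono_AE)
      show "AE x in lborel. ennreal (if min (X \<omega>) (Y \<omega>) \<le> x \<and> x \<le> max (X \<omega>) (Y \<omega>) then 2 * \<bar>x - X \<omega>\<bar> else 0)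
          \<le> ennreal (k x \<omega>) * indicator I x"
        using AE_lborel_singleton[of "Y \<omega>"] AE_lborel_singleton[of 0] AE_lborel_singleton[of 1]
      proof eventually_elim
        fix x :: real assume ne: "x \<noteq> Y \<omega>" "x \<noteq> 0" "x \<noteq> 1"
        show "ennreal (if min (X \<omega>) (Y \<omega>) \<le> x \<and> x \<le> max (X \<omega>) (Y \<omega>) then 2 * \<bar>x - X \<omega>\<bar> else 0)
          \<le> ennreal (k x \<omega>) * indicator I x"
        proof (cases "min (X \<omega>) (Y \<omega>) \<le> x \<and> x \<le> max (X \<omega>) (Y \<omega>)")
          case True
          then have "0 \<le> x" "x \<le> 1" using XY_range[OF w] by (auto simp: min_def max_def split: if_splits)
          then have "x \<in> I" using ne by simp
          from point[OF w this _ _ ne(1)] show ?thesis using True \<open>x \<in> I\<close> by (simp add: ennreal_leI)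
        next
          case False
          then show ?thesis by (subst if_not_P) auto
        qed
      qed
    qed
    finally show "ennreal ((X \<omega> - Y \<omega>)\<^sup>2) \<le> (\<integral>\<^sup>+x. ennreal (k x \<omega>) * indicator I x \<partial>lborel)" .
  qed
  \<comment> \<open>Extending the outer integral of a nonnegative function to the whole line
    prepares the exchange of the two integrals; the vertical segments are then integrated in
    full.\<close>
  also have "\<dots> \<le> (\<integral>\<^sup>+\<omega>. (\<integral>\<^sup>+x. ennreal (k x \<omega>) * indicator I x \<partial>lborel) \<partial>lborel)"
    by (subst nn_integral_restrict_space) (auto intro!: nn_integral_mono split: split_indicator)
  also have "\<dots> = (\<integral>\<^sup>+x. (\<integral>\<^sup>+\<omega>. ennreal (k x \<omega>) * indicator I x \<partial>lborel) \<partial>lborel)"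
    by (rule lborel_pair.Fubini') (simp add: split_beta')
  also have "\<dots> = (\<integral>\<^sup>+x. ennreal ((F x - G x)\<^sup>2 / c) * indicator I x \<partial>lborel)"
  proof (rule nn_integral_cong)
    fix x
    have "(\<integral>\<^sup>+\<omega>. ennreal (k x \<omega>) \<partial>lborel) = ennreal (1 / c) * ennreal ((F x - G x)\<^sup>2)"
    proof -
      have "ennreal (k x \<omega>) = ennreal (1 / c) * ennreal (if min (F x) (G x) \<le> \<omega> \<and> \<omega> \<le> max (F x) (G x)
          then 2 * \<bar>\<omega> - F x\<bar> else 0)" for \<omega>
        unfolding k_def using c by (intro ennreal_mult') simp
      then show ?thesis by (simp only: nn_integral_abs_diff[symmetric]) (intro nn_integral_cmult, measurable)
    qed
    also have "\<dots> = ennreal ((F x - G x)\<^sup>2 / c)" using c by (simp flip: ennreal_mult)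
    finally show "(\<integral>\<^sup>+\<omega>. ennreal (k x \<omega>) * indicator I x \<partial>lborel) = ennreal ((F x - G x)\<^sup>2 / c) * indicator I x"
      by (auto split: split_indicator)
  qed
  also have "\<dots> = (\<integral>\<^sup>+x. ennreal ((F x - G x)\<^sup>2 / c) \<partial>leb_I)"
    by (subst nn_integral_restrict_space) auto
  finally show ?thesis by (simp add: F_def G_def)
qed

section \<open>Measures with a density on the unit interval\<close>

lemma emeasure_density_measure:
  assumes f: "integrable leb_I f" "AE x in leb_I. 0 \<le> f x" and A: "A \<in> sets borel"
  shows "emeasure (density_measure f) A = ennreal (LINT x|leb_I. f x * indicator A x)"
proof -
  have [measurable]: "f \<in> borel_measurable leb_I" using f by auto
  have [measurable]: "(\<lambda>x. ennreal (f x) * indicator I x) \<in> borel_measurable lborel"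
    by (subst borel_measurable_restrict_space_iff_ennreal[symmetric]) auto
  have "emeasure (density_measure f) A = (\<integral>\<^sup>+x. ennreal (f x) * indicator I x * indicator A x \<partial>lborel)"
    unfolding density_measure_def using A by (intro emeasure_density) auto
  also have "\<dots> = (\<integral>\<^sup>+x. ennreal (f x * indicator A x) \<partial>leb_I)"
    by (subst nn_integral_restrict_space) (auto intro!: nn_integral_cong split: split_indicator)
  also have "\<dots> = ennreal (LINT x|leb_I. f x * indicator A x)"
  proof (intro nn_integral_eq_integral integrable_leb_I_indicator f(1) A)
    show "AE x in leb_I. 0 \<le> f x * indicator A x"
      using f(2) by eventually_elim simp
  qed
  finally show ?thesis .
qed

lemma cdf_density_measure:
  assumes f: "integrable leb_I f" "AE x in leb_I. 0 \<le> f x"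
  shows "cdf (density_measure f) x = (LINT y|leb_I. f y * indicator {..x} y)"
proof -
  have "0 \<le> (LINT y|leb_I. f y * indicator {..x} y)"
    by (rule integral_nonneg_AE) (use f(2) in \<open>eventually_elim, simp\<close>)
  then show ?thesis
    using emeasure_density_measure[OF f, of "{..x}"] by (simp add: cdf_def measure_def)
qed

lemma real_distribution_density_measure:
  assumes f: "integrable leb_I f" "AE x in leb_I. 0 \<le> f x" "(LINT x|leb_I. f x) = 1"
  shows "real_distribution (density_measure f)"
proof -
  have "emeasure (density_measure f) (space (density_measure f)) = 1"
    using emeasure_density_measure[OF f(1,2), of UNIV] f(3) by (simp add: density_measure_def)
  then show ?thesis
    by (intro real_distribution.intro prob_spaceI real_distribution_axioms.intro)
      (simp_all add: density_measure_def)
qed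

lemma cdf_density_measure_ends:
  assumes f: "integrable leb_I f" "AE x in leb_I. 0 \<le> f x" "(LINT x|leb_I. f x) = 1"
  shows "cdf (density_measure f) 0 = 0" "cdf (density_measure f) 1 = 1"
proof -
  have "(LINT y|leb_I. f y * indicator {..0} y) = (LINT y|leb_I. 0)"
    by (intro Bochner_Integration.integral_cong) auto
  then show "cdf (density_measure f) 0 = 0" using cdf_density_measure[OF f(1,2)] by simp
  have "(LINT y|leb_I. f y * indicator {..1} y) = (LINT y|leb_I. f y)"
    by (intro Bochner_Integration.integral_cong) auto
  then show "cdf (density_measure f) 1 = 1" using cdf_density_measure[OF f(1,2)] f(3) by simp
qed

text \<open>The lower bound on \<open>u\<close> is the slope condition for its distribution
  function. The difference of the distribution functions is at most the L1 distance of the densities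
  at every point, hence at most their L2 distance.\<close>

lemma W2_squared_density_measure_le:
  assumes u: "u \<in> L2_I" "(LINT x|leb_I. u x) = 1" and v: "v \<in> L2_I" "(LINT x|leb_I. v x) = 1" "AE x in leb_I. 0 \<le> v x"
    and c: "0 < c" "AE x in leb_I. c \<le> u x"
  shows "W2_squared (density_measure u) (density_measure v) \<le> ennreal ((L2_dist v u)\<^sup>2 / c)"
proof -
  have u': "integrable leb_I u" and v': "integrable leb_I v" using u v by (auto intro: L2_I_integrable)
  have u0: "AE x in leb_I. 0 \<le> u x" using c(2) by eventually_elim (use c(1) in simp)
  let ?F = "cdf (density_measure u)" and ?G = "cdf (density_measure v)"
  have "W2_squared (density_measure u) (density_measure v) \<le> (\<integral>\<^sup>+x. ennreal ((?F x - ?G x)\<^sup>2 / c) \<partial>leb_I)"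
  proof (rule W2_squared_le_cdf)
    fix x y :: real assume xy: "0 \<le> x" "x \<le> y" "y \<le> 1"
    have "(LINT z|leb_I. indicator {x<..y} z) = y - x"
    proof -
      have "(LINT z|leb_I. indicator {x<..y} z :: real) = (LINT z|leb_I. 1 * indicator {x<..} z - 1 * indicator {y<..} z)"
        using xy by (intro Bochner_Integration.integral_cong) (auto split: split_indicator)
      also have "\<dots> = (LINT z|leb_I. 1 * indicator {x<..} z) - (LINT z|leb_I. 1 * indicator {y<..} z)"
        by (intro Bochner_Integration.integral_diff integrable_leb_I_indicator) auto
      also have "\<dots> = (1 - x) - (1 - y)"
        using integral_leb_I_FTC[of "\<lambda>x. x" "\<lambda>x. 1" x] integral_leb_I_FTC[of "\<lambda>x. x" "\<lambda>x. 1" y] xy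
        by (simp add: DERIV_ident)
      finally show ?thesis by simp
    qed
    then have "c * (y - x) = (LINT z|leb_I. c * indicator {x<..y} z)" by simp
    also have "\<dots> \<le> (LINT z|leb_I. u z * indicator {x<..y} z)"
    proof (rule integral_mono_AE)
      show "AE z in leb_I. c * indicator {x<..y} z \<le> u z * indicator {x<..y} z"
        using c(2) by eventually_elim (auto split: split_indicator)
    qed (intro integrable_leb_I_indicator u'; simp)+
    also have "\<dots> = (LINT z|leb_I. u z * indicator {..y} z - u z * indicator {..x} z)"
      using xy by (intro Bochner_Integration.integral_cong) (auto split: split_indicator)
    also have "\<dots> = ?F y - ?F x"
      unfolding cdf_density_measure[OF u' u0]
      by (intro Bochner_Integration.integral_diff integrable_leb_I_indicator u') auto
    finally show "c * (y - x) \<le> ?F y - ?F x" .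
  qed (use u u' u0 v v' c in \<open>auto intro!: real_distribution_density_measure cdf_density_measure_ends\<close>)
  also have "\<dots> \<le> (\<integral>\<^sup>+x. ennreal ((L2_dist v u)\<^sup>2 / c) \<partial>leb_I)"
  proof (intro nn_integral_mono ennreal_leI divide_right_mono)
    fix x
    have d: "(\<lambda>y. v y - u y) \<in> L2_I" using v(1) u(1) by (rule L2_I_diff)
    have "?F x - ?G x = (LINT y|leb_I. u y * indicator {..x} y - v y * indicator {..x} y)"
      unfolding cdf_density_measure[OF u' u0] cdf_density_measure[OF v' v(3)]
      by (intro Bochner_Integration.integral_diff[symmetric] integrable_leb_I_indicator u' v') auto
    also have "\<bar>\<dots>\<bar> \<le> (LINT y|leb_I. \<bar>u y * indicator {..x} y - v y * indicator {..x} y\<bar>)"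
      by (rule integral_abs_bound)
    also have "\<dots> \<le> (LINT y|leb_I. \<bar>v y - u y\<bar>)"
      by (intro integral_mono integrable_abs Bochner_Integration.integrable_diff integrable_leb_I_indicator u' v')
        (auto split: split_indicator)
    also have "\<dots> \<le> L2_dist v u" unfolding L2_dist_def by (rule L1_le_L2_norm[OF d])
    finally show "(?F x - ?G x)\<^sup>2 \<le> (L2_dist v u)\<^sup>2"
      by (simp only: abs_le_square_iff[symmetric] abs_of_nonneg[OF L2_dist_nonneg])
  qed (use c in auto)
  also have "\<dots> = ennreal ((L2_dist v u)\<^sup>2 / c)"
    using leb_I.emeasure_space_1 by simp
  finally show ?thesis .
qed

text \<open>The bound \<open>c\<close> keeps the essential infimum from being minus infinity, and
  the positive measure of \<open>I\<close> keeps it from being plus infinity. It is itself an a.e.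
  lower bound, so the transport estimate can be applied with it instead of with the given
  \<open>c\<close>.\<close>

lemma ess_inf_attained:
  assumes f: "f \<in> borel_measurable leb_I" and c: "AE x in leb_I. c \<le> f x"
  obtains m where "ess_inf f = ereal m" "c \<le> m" "AE x in leb_I. m \<le> f x"
proof -
  let ?s = "esssup leb_I (\<lambda>x. - ereal (f x))"
  have "?s \<le> - ereal c"
    using f c by (intro esssup_I) (auto elim!: eventually_mono)
  then have "- (- ereal c) \<le> - ?s" by (simp only: ereal_minus_le_minus)
  then have lower: "ereal c \<le> ess_inf f" by (simp add: ess_inf_def)
  have AE: "AE x in leb_I. ess_inf f \<le> ereal (f x)"
    using esssup_AE[of "\<lambda>x. - ereal (f x)" leb_I]
    by eventually_elim (simp add: ess_inf_def ereal_uminus_le_reorder)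
  have "ess_inf f \<noteq> \<infinity>"
  proof
    assume "ess_inf f = \<infinity>"
    then have "AE x in leb_I. False" using AE by simp
    then show False using leb_I.AE_False by simp
  qed
  with lower obtain m where "ess_inf f = ereal m" by (cases "ess_inf f") auto
  with lower AE that show ?thesis by simp
qed

theorem theorem6p11:
  shows "\<exists>C::real. C > 0 \<and>
    (\<forall>u uinf :: real \<Rightarrow> real.
       u \<in> decomposable \<longrightarrow>
       (AE x in leb_I. 0 < u x) \<longrightarrow>
       (\<exists>c>0. AE x in leb_I. c \<le> u x) \<longrightarrow>
       (LINT x|leb_I. u x) = 1 \<longrightarrow>
       is_P_infinity u uinf \<longrightarrow>
       enn2ereal (W2_squared (density_measure u) (density_measure uinf))
         \<le> ereal C / ess_inf u * directed_energy u)"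
proof (intro exI[of _ 8] conjI allI impI)
  fix u v :: "real \<Rightarrow> real"
  assume u: "u \<in> decomposable" and pos: "AE x in leb_I. 0 < u x"
    and "\<exists>c>0. AE x in leb_I. c \<le> u x" and mass: "(LINT x|leb_I. u x) = 1" and v: "is_P_infinity u v"
  then obtain c where c: "0 < c" "AE x in leb_I. c \<le> u x" by blast
  have L2: "u \<in> L2_I" "v \<in> L2_I" using u v by (auto simp: decomposable_def is_P_infinity_def)
  obtain m where m: "ess_inf u = ereal m" "c \<le> m" "AE x in leb_I. m \<le> u x"
    using ess_inf_attained[OF L2_I_measurable[OF L2(1)] c(2)] .
  have m0: "0 < m" using c(1) m(2) by simp
  have v0: "AE x in leb_I. 0 \<le> v x"
    using pos by (intro P_infinity_nonneg[OF u _ v]) (auto elim!: eventually_mono)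
  have "W2_squared (density_measure u) (density_measure v) \<le> ennreal ((L2_dist v u)\<^sup>2 / m)"
    using P_infinity_mass[OF u v] by (intro W2_squared_density_measure_le L2 mass v0 m0 m(3)) (simp add: mass)
  also have "\<dots> \<le> ennreal (8 / m * dirichlet (down_part u))"
    using P_infinity_dist_initial[OF u v] m0 by (intro ennreal_leI) (simp add: field_simps)
  finally have "enn2ereal (W2_squared (density_measure u) (density_measure v))
      \<le> enn2ereal (ennreal (8 / m * dirichlet (down_part u)))"
    by (simp add: less_eq_ennreal.rep_eq)
  also have "\<dots> = ereal 8 / ess_inf u * directed_energy u"
    using u m0 by (simp add: directed_energy_def m(1) enn2ereal_ennreal)
  finally show "enn2ereal (W2_squared (density_measure u) (density_measure v))
      \<le> ereal 8 / ess_inf u * directed_energy u" .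
qed simp

end
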